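(* For $p\in(0,1/2)$ let $\nu$ be the probability measure on $\{a,a^{-1},b,b^{-1}\}\subset B_3$ given by $\nu(a)=\nu(a^{-1})=p$ and $\nu(b)=\nu(b^{-1})=1/2-p$, and let $\gamma(p),\gamma_{\Sigma}(p),\gamma_{S_+}(p),\gamma_{\Delta}(p)$ be the drifts of the random walk $(B_3,\nu)$ as defined in the context. Assume that $p\in(0,1/4]$ and let $u$ be the smallest root in $(0,1)$ of the polynomial $$P=2(4p-1)X^3+(24p^2-18p+1)X^2+p(-12p+7)X+p(2p-1).$$ Then $$\gamma(p)=\gamma_{\Sigma}(p)=-2\gamma_{\Delta}(p)=\tfrac{2}{3}\gamma_{S_+}(p)=p+(1-4p)u.$$ For $p\in[1/4,1/2)$ one has $\gamma(p)=\gamma(1/2-p)$, $\gamma_{\Sigma}(p)=\gamma_{\Sigma}(1/2-p)$, $\gamma_{S_+}(p)=\gamma_{S_+}(1/2-p)$ and $\gamma_{\Delta}(p)=\gamma_{\Delta}(1/2-p)$.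
   Context: $B_3=\langle a,b\mid aba=bab\rangle$ is the braid group on three strands, $S=\{a,a^{-1},b,b^{-1}\}$, and $|g|_S$ is the word length of $g\in B_3$ with respect to $S$. Put $\Delta=aba=bab$ and $T=\{a,b,ab,ba\}\subset B_3$. Define $\mathrm{First}$ and $\mathrm{Last}$ on $T$ as the first and last letter: $\mathrm{First}(a)=\mathrm{Last}(a)=a$, $\mathrm{First}(b)=\mathrm{Last}(b)=b$, $\mathrm{First}(ab)=a$, $\mathrm{Last}(ab)=b$, $\mathrm{First}(ba)=b$, $\mathrm{Last}(ba)=a$. Every $g\in B_3$ can be written in a unique way as $g=t_1\cdots t_l\Delta^{k}$ with $l\ge 0$, $t_i\in T$, $\mathrm{Last}(t_i)=\mathrm{First}(t_{i+1})$ for $1\le i<l$, and $k\in\mathbb{Z}$ (Garside normal form). Write $\widehat g=t_1\cdots t_l$, let $|\widehat g|_T=l$ be the number of factors in $T$, and let $|\widehat g|_{S_+}$ ($S_+=\{a,b\}$) be the total number of letters $a,b$ in $t_1\cdots t_l$, i.e. the factors $a,b$ count for $1$ and the factors $ab,ba$ count for $2$. For a probability measure $\nu$ on $S$, a realization of the random walk $(B_3,\nu)$ is $X_n=x_1x_2\cdots x_n$, $X_0=1$, with $(x_i)$ i.i.d. of law $\nu$. Write the Garside normal form of $X_n$ as $\widehat X_n\Delta^{k_n}$. The drifts are the almost sure (constant) limits $$\gamma=\lim_n\frac{|X_n|_S}{n},\quad \gamma_{\Sigma}=\lim_n\frac{|\widehat X_n|_T}{n},\quad \gamma_{S_+}=\lim_n\frac{|\widehat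 X_n|_{S_+}}{n},\quad \gamma_{\Delta}=\lim_n\frac{k_n}{n}.$$ *)

theory Defs
  imports "HOL-Probability.Probability" "HOL-Computational_Algebra.Polynomial"
begin

section \<open>The braid group on three strands\<close>

datatype gen = GA | GB

text \<open>\<open>(x, True)\<close> stands for the generator \<open>x\<close> and \<open>(x, False)\<close> for its formal inverse.\<close>

type_synonym letter = "gen \<times> bool"

text \<open>The congruence on words that presents the group with generators \<open>a, b\<close> and the single
  relation \<open>aba = bab\<close>.\<close>

inductive braid_eq :: "letter list \<Rightarrow> letter list \<Rightarrow> bool" where
  refl: "braid_eq u u"
| sym: "braid_eq u v \<Longrightarrow> braid_eq v u"
| trans: "braid_eq u v \<Longrightarrow> braid_eq v w \<Longrightarrow> braid_eq u w"
| append: "braid_eq u u' \<Longrightarrow> braid_eq v v' \<Longrightarrow> braid_eq (u @ v) (u' @ v')"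
| cancel: "braid_eq [(x, e), (x, \<not> e)] []"
| braid: "braid_eq [(GA, True), (GB, True), (GA, True)] [(GB, True), (GA, True), (GB, True)]"

definition inv_word :: "letter list \<Rightarrow> letter list" where
  "inv_word w = rev (map (\<lambda>(x, e). (x, \<not> e)) w)"

lemma inv_word_simps [simp]:
  "inv_word [] = []"
  "inv_word ((x, e) # w) = inv_word w @ [(x, \<not> e)]"
  "inv_word (u @ v) = inv_word v @ inv_word u"
  by (simp_all add: inv_word_def)

lemma braid_eq_inv_word_left: "braid_eq (inv_word w @ w) []"
proof (induction w)
  case Nil
  show ?case by (simp add: braid_eq.refl)
next
  case (Cons l w)
  obtain x e where l: "l = (x, e)" by (cases l)
  have "braid_eq [(x, \<not> e), (x, e)] []"
    using braid_eq.cancel[of x "\<not> e"] by simp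
  from braid_eq.append[OF braid_eq.append[OF braid_eq.refl[of "inv_word w"] this]
      braid_eq.refl[of w]]
  have "braid_eq (inv_word (l # w) @ l # w) (inv_word w @ w)"
    by (simp add: l)
  with Cons show ?case by (blast intro: braid_eq.trans)
qed

lemma inv_word_inv_word [simp]: "inv_word (inv_word w) = w"
  by (simp add: inv_word_def rev_map comp_def case_prod_beta)

lemma braid_eq_inv_word_right: "braid_eq (w @ inv_word w) []"
  using braid_eq_inv_word_left[of "inv_word w"] by simp

lemma braid_eq_inv_word:
  assumes "braid_eq u v"
  shows "braid_eq (inv_word u) (inv_word v)"
proof -
  have "braid_eq (inv_word u @ (v @ inv_word v)) (inv_word u @ [])"
    by (intro braid_eq.append braid_eq.refl braid_eq_inv_word_right)
  moreover have "braid_eq ((inv_word u @ v) @ inv_word v) ((inv_word u @ u) @ inv_word v)"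
    by (intro braid_eq.append braid_eq.refl braid_eq.sym[OF assms])
  moreover have "braid_eq ((inv_word u @ u) @ inv_word v) ([] @ inv_word v)"
    by (intro braid_eq.append braid_eq.refl braid_eq_inv_word_left)
  ultimately show ?thesis
    by simp (blast intro: braid_eq.trans braid_eq.sym)
qed

quotient_type braid3 = "letter list" / braid_eq
  by (rule equivpI)
    (auto intro!: reflpI sympI transpI intro: braid_eq.refl braid_eq.sym braid_eq.trans)

text \<open>The library has no type class for non-commutative multiplicative groups, so \<open>braid3\<close> is made
  a monoid with an \<open>inverse\<close> satisfying the group laws below; this also provides \<open>powi\<close>.\<close>

instantiation braid3 :: "{monoid_mult, inverse}"
begin

lift_definition one_braid3 :: braid3 is "[]" .

lift_definition times_braid3 :: "braid3 \<Rightarrow> braid3 \<Rightarrow> braid3" is "(@)"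
  by (rule braid_eq.append)

lift_definition inverse_braid3 :: "braid3 \<Rightarrow> braid3" is inv_word
  by (rule braid_eq_inv_word)

definition divide_braid3 :: "braid3 \<Rightarrow> braid3 \<Rightarrow> braid3" where
  "divide_braid3 g h = g * inverse h"

instance
  by standard (transfer, simp add: braid_eq.refl)+

end

lemma braid3_left_inverse: "inverse g * g = (1 :: braid3)"
  by transfer (rule braid_eq_inv_word_left)

lemma braid3_right_inverse: "g * inverse g = (1 :: braid3)"
  by transfer (rule braid_eq_inv_word_right)

lift_definition gen_braid :: "gen \<Rightarrow> braid3" is "\<lambda>x. [(x, True)]" .

definition br_a :: braid3 where "br_a = gen_braid GA"
definition br_b :: braid3 where "br_b = gen_braid GB"
definition br_Delta :: braid3 where "br_Delta = br_a * br_b * br_a"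

lemma br_Delta_alt: "br_Delta = br_b * br_a * br_b"
  unfolding br_Delta_def br_a_def br_b_def
  by transfer (simp add: braid_eq.braid)

definition gens_S :: "braid3 set" where
  "gens_S = {br_a, inverse br_a, br_b, inverse br_b}"

definition word_length :: "'g::monoid_mult set \<Rightarrow> 'g \<Rightarrow> nat" where
  "word_length S g = (LEAST n. \<exists>xs. set xs \<subseteq> S \<and> length xs = n \<and> prod_list xs = g)"


section \<open>Garside normal form\<close>

text \<open>The elements of \<open>T = {a, b, ab, ba}\<close> are represented by the words spelling them, so that
  \<open>First\<close> and \<open>Last\<close> are \<^const>\<open>hd\<close> and \<^const>\<open>last\<close>.\<close>

definition garside_T :: "gen list set" where
  "garside_T = {[GA], [GB], [GA, GB], [GB, GA]}"

definition pos_eval :: "gen list \<Rightarrow> braid3" where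
  "pos_eval t = prod_list (map gen_braid t)"

definition is_garside_nf :: "braid3 \<Rightarrow> gen list list \<Rightarrow> int \<Rightarrow> bool" where
  "is_garside_nf g ts k \<longleftrightarrow>
     set ts \<subseteq> garside_T \<and>
     (\<forall>i. Suc i < length ts \<longrightarrow> last (ts ! i) = hd (ts ! Suc i)) \<and>
     g = prod_list (map pos_eval ts) * br_Delta powi k"

definition garside_nf :: "braid3 \<Rightarrow> gen list list \<times> int" where
  "garside_nf g = (THE (ts, k). is_garside_nf g ts k)"

definition hat_length_T :: "braid3 \<Rightarrow> nat" where
  "hat_length_T g = length (fst (garside_nf g))"

definition hat_length_Splus :: "braid3 \<Rightarrow> nat" where
  "hat_length_Splus g = (\<Sum>t\<leftarrow>fst (garside_nf g). length t)"

definition Delta_exponent :: "braid3 \<Rightarrow> int" where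
  "Delta_exponent g = snd (garside_nf g)"


section \<open>Random walk and drifts\<close>

text \<open>A point \<open>x\<close> of the path space is the sequence of i.i.d. increments, with \<open>x i\<close> the
  \<open>(i + 1)\<close>-st step.\<close>

definition step_space :: "'g pmf \<Rightarrow> (nat \<Rightarrow> 'g) measure" where
  "step_space \<nu> = (\<Pi>\<^sub>M i\<in>UNIV. measure_pmf \<nu>)"

definition walk :: "(nat \<Rightarrow> 'g::monoid_mult) \<Rightarrow> nat \<Rightarrow> 'g" where
  "walk x n = prod_list (map x [0..<n])"

definition has_drift :: "'g::monoid_mult pmf \<Rightarrow> ('g \<Rightarrow> real) \<Rightarrow> real \<Rightarrow> bool" where
  "has_drift \<nu> f c \<longleftrightarrow> (AE x in step_space \<nu>. (\<lambda>n. f (walk x n) / real n) \<longlonglongrightarrow> c)"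

text \<open>Only meaningful if some \<open>c\<close> satisfies \<open>has_drift \<nu> f c\<close>; such a \<open>c\<close> is unique.\<close>

definition drift :: "'g::monoid_mult pmf \<Rightarrow> ('g \<Rightarrow> real) \<Rightarrow> real" where
  "drift \<nu> f = (THE c. has_drift \<nu> f c)"

text \<open>A probability measure only for \<open>0 \<le> p \<le> 1/2\<close>.\<close>

definition step_law :: "real \<Rightarrow> braid3 pmf" where
  "step_law p = pmf_of_list
     [(br_a, p), (inverse br_a, p), (br_b, 1/2 - p), (inverse br_b, 1/2 - p)]"

abbreviation len_S :: "braid3 \<Rightarrow> real" where "len_S g \<equiv> real (word_length gens_S g)"
abbreviation len_T :: "braid3 \<Rightarrow> real" where "len_T g \<equiv> real (hat_length_T g)"
abbreviation len_Splus :: "braid3 \<Rightarrow> real" where "len_Splus g \<equiv> real (hat_length_Splus g)"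
abbreviation exp_Delta :: "braid3 \<Rightarrow> real" where "exp_Delta g \<equiv> real_of_int (Delta_exponent g)"

definition drift_S :: "real \<Rightarrow> real" where "drift_S p = drift (step_law p) len_S"
definition drift_T :: "real \<Rightarrow> real" where "drift_T p = drift (step_law p) len_T"
definition drift_Splus :: "real \<Rightarrow> real" where "drift_Splus p = drift (step_law p) len_Splus"
definition drift_Delta :: "real \<Rightarrow> real" where "drift_Delta p = drift (step_law p) exp_Delta"

definition drift_poly :: "real \<Rightarrow> real poly" where
  "drift_poly p =
     [:p * (2 * p - 1), p * (- 12 * p + 7), 24 * p\<^sup>2 - 18 * p + 1, 2 * (4 * p - 1):]"

definition is_smallest_root_01 :: "real poly \<Rightarrow> real \<Rightarrow> bool" where
  "is_smallest_root_01 P u \<longleftrightarrow>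
     u \<in> {0<..<1} \<and> poly P u = 0 \<and> (\<forall>v\<in>{0<..<1}. poly P v = 0 \<longrightarrow> u \<le> v)"

end

(* A point of the Garside normal form of X_n is a stack of factors together with the parity of
   the exponent of Delta, and one step of the walk only changes the top of the stack. Let x and y
   (resp. x' and y') be the probabilities that the top factor is eventually removed, without or
   with a change of frame, when it is cancelled by a (resp. by b). They satisfy a quadratic
   "traffic" system and describe a Markov-type stationary measure on the boundary of the group.
   Averaging the length cocycle over this measure gives a bounded function h of the stack such
   that length + h increases in mean by the same amount, the speed, at every element of the group.
   A function with bounded increments and constant mean increment has a drift by a fourth-moment
   estimate, so no ergodic theorem is needed.
   The same computation with arbitrary weights on short and long factors shows that both kinds
   are equally frequent; the exponent sum of the walk has drift 0, which yields the drift of the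
   exponent of Delta. A long factor is an inverse generator times Delta, so |g| lies between the
   number of factors and that number plus an error of drift 0. Finally x + y is twice a root of
   the polynomial. *)

theory Submission
  imports Defs
begin

section \<open>Drift of functions with constant mean increment\<close>

instance gen :: countable
  by countable_datatype

text \<open>Products of countable discrete spaces are discrete, which makes multiplication, and
  hence every function of the walk, measurable.\<close>

instance braid3 :: countable
proof
  have "inj (\<lambda>g. to_nat (rep_braid3 g))"
    by (intro injI) (metis Quotient3_braid3 Quotient3_rel_rep from_nat_to_nat Quotient3_abs_rep)
  then show "\<exists>f :: braid3 \<Rightarrow> nat. inj f" by blast
qed

lemma walk_0 [simp]: "walk x 0 = 1"
  by (simp add: walk_def)

lemma walk_Suc: "walk x (Suc n) = walk x n * x n"
  by (simp add: walk_def)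

lemma walk_case_nat: "walk (case_nat s x) (Suc n) = s * walk x n"
proof -
  have "map (case_nat s x) [0..<Suc n] = s # map x [0..<n]"
    by (simp add: upt_conv_Cons map_Suc_upt[symmetric] del: upt_Suc)
  then show ?thesis by (simp add: walk_def)
qed

lemma measurable_walk [measurable]:
  fixes \<nu> :: "'g::{monoid_mult,countable} pmf"
  shows "(\<lambda>x. walk x n) \<in> measurable (step_space \<nu>) (count_space UNIV)"
proof (induction n)
  case (Suc n)
  have x: "(\<lambda>x. x n) \<in> measurable (step_space \<nu>) (count_space UNIV)"
    unfolding step_space_def by measurable
  have "(\<lambda>(g, h). g * h) \<in> measurable (count_space UNIV \<Otimes>\<^sub>M count_space UNIV) (count_space (UNIV :: 'g set))"
    by (simp add: pair_measure_countable)
  from measurable_compose[OF measurable_Pair[OF Suc x] this] show ?case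
    by (simp add: walk_Suc)
qed simp

lemma prob_space_step_space: "prob_space (step_space \<nu>)"
  unfolding step_space_def by (intro prob_space_PiM measure_pmf.prob_space_axioms)

text \<open>The walk is split at its first step: prepending an independent step preserves the law on
  the path space and multiplies the walk from the left.\<close>

lemma nn_integral_walk_Suc:
  fixes \<nu> :: "'g::{monoid_mult,countable} pmf" and f :: "'g \<Rightarrow> ennreal"
  shows "(\<integral>\<^sup>+x. f (walk x (Suc n)) \<partial>step_space \<nu>) =
    (\<integral>\<^sup>+s. (\<integral>\<^sup>+x. f (s * walk x n) \<partial>step_space \<nu>) \<partial>measure_pmf \<nu>)"
proof -
  interpret S: sequence_space "measure_pmf \<nu>"
    by (simp add: sequence_space_def product_prob_space_def product_sigma_finite_def
        product_prob_space_axioms_def measure_pmf.sigma_finite_measure_axioms measure_pmf.prob_space_axioms)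
  have S: "step_space \<nu> = S.S" by (simp add: step_space_def)
  have "prob_space S.S" using prob_space_step_space[of \<nu>] by (simp add: S)
  then have sf: "sigma_finite_measure S.S"
    by (intro finite_measure.axioms(1) prob_space.finite_measure)
  have [measurable]: "(\<lambda>x. walk x n) \<in> measurable S.S (count_space UNIV)" for n
    using measurable_walk[of n \<nu>] by (simp add: S)
  have "(\<integral>\<^sup>+x. f (walk x (Suc n)) \<partial>S.S) =
      (\<integral>\<^sup>+x. f (walk x (Suc n)) \<partial>distr (measure_pmf \<nu> \<Otimes>\<^sub>M S.S) S.S (\<lambda>(s, \<omega>). case_nat s \<omega>))"
    by (simp only: S.PiM_iter)
  also have "\<dots> = (\<integral>\<^sup>+z. f (walk (case_nat (fst z) (snd z)) (Suc n)) \<partial>(measure_pmf \<nu> \<Otimes>\<^sub>M S.S))"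
    by (subst nn_integral_distr) (auto simp: case_prod_beta)
  also have "\<dots> = (\<integral>\<^sup>+z. f (fst z * walk (snd z) n) \<partial>(measure_pmf \<nu> \<Otimes>\<^sub>M S.S))"
    by (simp only: walk_case_nat)
  also have "\<dots> = (\<integral>\<^sup>+s. (\<integral>\<^sup>+x. f (s * walk x n) \<partial>S.S) \<partial>measure_pmf \<nu>)"
  proof (subst sigma_finite_measure.nn_integral_fst[OF sf, symmetric])
    show "(\<lambda>z. f (fst z * walk (snd z) n)) \<in> borel_measurable (measure_pmf \<nu> \<Otimes>\<^sub>M S.S)"
    proof -
      have [measurable]: "fst \<in> measurable (measure_pmf \<nu> \<Otimes>\<^sub>M S.S) (count_space UNIV)"
        using measurable_fst[of "measure_pmf \<nu>" S.S] by (simp cong: measurable_cong_sets)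
      show ?thesis by measurable
    qed
  qed simp
  finally show ?thesis by (simp add: S)
qed

text \<open>With \<open>k\<close> steps to go, \<open>m^4 + 8*b^2*k*m^2 + 4*b^4*k^2\<close> is a
  Lyapunov function: losing one unit of \<open>k\<close> pays for a step \<open>d\<close>, up to a
  term linear in \<open>d\<close>, which vanishes in mean.\<close>

lemma fourth_moment_step:
  fixes m d b :: real
  assumes "\<bar>d\<bar> \<le> b" and "0 \<le> k"
  shows "(m + d)^4 + 8*b^2*k*(m + d)^2 + 4*b^4*k^2
    \<le> (m^4 + 8*b^2*(k+1)*m^2 + 4*b^4*(k+1)^2) + (4*m^3 + 16*b^2*k*m) * d"
proof -
  have d2: "d^2 \<le> b^2" using power_mono[OF assms(1), of 2] by simp
  have d4: "d^4 \<le> b^4" using power_mono[OF d2, of 2] by (simp flip: power_mult)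
  \<comment> \<open>The term \<open>4*m*d^3\<close> has no sign; a square bounds it by even
    terms.\<close>
  have "0 \<le> 2 * (m*d - d^2)^2" by simp
  then have c: "4*m*d^3 \<le> 2*m^2*d^2 + 2*d^4"
    by (simp add: power2_eq_square power3_eq_cube power4_eq_xxxx algebra_simps)
  have m2: "m^2 * d^2 \<le> m^2 * b^2" by (intro mult_left_mono d2) simp
  have k: "b^2*k*d^2 \<le> b^2*k*b^2" by (intro mult_left_mono d2) (simp add: assms)
  have "(m + d)^4 + 8*b^2*k*(m + d)^2 + 4*b^4*k^2 - (4*m^3 + 16*b^2*k*m) * d
     = m^4 + 6*(m^2*d^2) + 4*m*d^3 + d^4 + 8*b^2*k*m^2 + 8*(b^2*k*d^2) + 4*b^4*k^2"
    by (simp add: power2_eq_square power3_eq_cube power4_eq_xxxx algebra_simps)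
  also have "\<dots> \<le> m^4 + 8*(m^2*b^2) + 3*b^4 + 8*b^2*k*m^2 + 8*(b^2*k*b^2) + 4*b^4*k^2"
    using c m2 d4 k by linarith
  also have "\<dots> \<le> m^4 + 8*b^2*(k+1)*m^2 + 4*b^4*(k+1)^2"
  proof -
    have "0 \<le> b^4" by simp
    then show ?thesis by (simp add: power2_eq_square power4_eq_xxxx algebra_simps)
  qed
  finally show ?thesis by linarith
qed

text \<open>Here \<open>f (walk x n) - n * c\<close> is a martingale with increments bounded by
  \<open>b + \<bar>c\<bar>\<close>.\<close>

context
  fixes \<nu> :: "'g::{monoid_mult,countable} pmf" and f :: "'g \<Rightarrow> real" and b c :: real
  assumes bounded_increments: "\<And>g s. s \<in> set_pmf \<nu> \<Longrightarrow> \<bar>f (g * s) - f g\<bar> \<le> b"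
    and mean_increment: "\<And>g. measure_pmf.expectation \<nu> (\<lambda>s. f (g * s)) = f g + c"
begin

lemma walk_fourth_moment:
  "(\<integral>\<^sup>+x. ennreal ((f (g * walk x n) - d - n * c)^4) \<partial>step_space \<nu>) \<le>
    ennreal ((f g - d)^4 + 8 * (b + \<bar>c\<bar>)^2 * n * (f g - d)^2 + 4 * (b + \<bar>c\<bar>)^4 * (real n)^2)"
\<comment> \<open>The first step moves the start to \<open>g * s\<close> and the centre to
  \<open>d + c\<close>, so both vary in the induction.\<close>
proof (induction n arbitrary: g d)
  case 0
  interpret prob_space "step_space \<nu>" by (rule prob_space_step_space)
  show ?case by (simp add: emeasure_space_1)
next
  case (Suc n)
  let ?b = "b + \<bar>c\<bar>" and ?m = "f g - d" and ?k = "real n"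
  define D where "D s = f (g * s) - c - f g" for s
  define C where "C = ?m^4 + 8*?b^2*(?k+1)*?m^2 + 4*?b^4*(?k+1)^2"
  define e where "e = 4*?m^3 + 16*?b^2*?k*?m"
  have D: "\<bar>D s\<bar> \<le> ?b" if "s \<in> set_pmf \<nu>" for s
    using bounded_increments[OF that, of g] by (simp add: D_def)
  have int_f: "integrable \<nu> (\<lambda>s. f (g * s))"
  proof (rule measure_pmf.integrable_const_bound)
    show "AE s in \<nu>. norm (f (g * s)) \<le> \<bar>f g\<bar> + b"
      using bounded_increments[of _ g] by (force simp: AE_measure_pmf_iff)
  qed simp
  have int_D: "integrable \<nu> D" "measure_pmf.expectation \<nu> D = 0"
    unfolding D_def using int_f mean_increment[of g] by auto
  have pointwise: "(f (g * s) - (d+c))^4 + 8*?b^2*?k*(f (g * s) - (d+c))^2 + 4*?b^4*?k^2 \<le> C + e * D s"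
    if "s \<in> set_pmf \<nu>" for s
  proof -
    have "f (g * s) - (d + c) = ?m + D s" by (simp add: D_def)
    then show ?thesis
      unfolding C_def e_def using fourth_moment_step[OF D[OF that], of ?k ?m] by (simp only: of_nat_0_le_iff)
  qed
  have "(\<integral>\<^sup>+x. ennreal ((f (g * walk x (Suc n)) - d - Suc n * c)^4) \<partial>step_space \<nu>)
    = (\<integral>\<^sup>+s. (\<integral>\<^sup>+x. ennreal ((f ((g * s) * walk x n) - (d + c) - n * c)^4) \<partial>step_space \<nu>) \<partial>measure_pmf \<nu>)"
    by (subst nn_integral_walk_Suc) (simp add: mult.assoc diff_diff_eq ring_distribs add.assoc)
  also have "\<dots> \<le> (\<integral>\<^sup>+s. ennreal ((f (g * s) - (d+c))^4 + 8*?b^2*?k*(f (g * s) - (d+c))^2 + 4*?b^4*?k^2) \<partial>measure_pmf \<nu>)"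
    by (intro nn_integral_mono Suc.IH)
  also have "\<dots> \<le> (\<integral>\<^sup>+s. ennreal (C + e * D s) \<partial>measure_pmf \<nu>)"
    by (intro nn_integral_mono_AE AE_pmfI ennreal_leI pointwise)
  also have "\<dots> = ennreal (measure_pmf.expectation \<nu> (\<lambda>s. C + e * D s))"
  proof (rule nn_integral_eq_integral)
    show "AE s in \<nu>. 0 \<le> C + e * D s"
      by (rule AE_pmfI, rule order.trans[OF _ pointwise]) simp_all
  qed (use int_D in auto)
  also have "measure_pmf.expectation \<nu> (\<lambda>s. C + e * D s) = C" using int_D by simp
  finally show ?case by (simp add: C_def add.commute)
qed

text \<open>The centred fourth moment is of order \<open>n^2\<close>. Divided by \<open>n^4\<close>
  it is summable, so almost surely the normalised fourth powers form a convergent series and tend to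
  0.\<close>

lemma has_drift_of_mean_increment: "has_drift \<nu> f c"
proof -
  define Y where "Y n x = ((f (walk x n) - f 1 - n * c) / n)^4" for n x
  let ?K = "4 * (b + \<bar>c\<bar>)^4"
  have [measurable]: "(\<lambda>x. g (walk x n)) \<in> borel_measurable (step_space \<nu>)" for n and g :: "'g \<Rightarrow> real"
    by measurable
  have Y_meas [measurable]: "Y n \<in> borel_measurable (step_space \<nu>)" for n
    unfolding Y_def by measurable
  have Y_nonneg: "0 \<le> Y n x" for n x by (simp add: Y_def)
  have Y_le: "(\<integral>\<^sup>+x. ennreal (Y n x) \<partial>step_space \<nu>) \<le> ennreal (?K * (1 / real n ^ 2))" for n
  proof (cases "n = 0")
    case False
    have "(\<integral>\<^sup>+x. ennreal (Y n x) \<partial>step_space \<nu>)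
      = (\<integral>\<^sup>+x. ennreal (1 / real n ^ 4) * ennreal ((f (1 * walk x n) - f 1 - n * c)^4) \<partial>step_space \<nu>)"
      by (simp add: Y_def power_divide flip: ennreal_mult)
    also have "\<dots> = ennreal (1 / real n ^ 4) * (\<integral>\<^sup>+x. ennreal ((f (1 * walk x n) - f 1 - n * c)^4) \<partial>step_space \<nu>)"
      by (intro nn_integral_cmult) measurable
    also have "\<dots> \<le> ennreal (1 / real n ^ 4) * ennreal (?K * (real n)^2)"
      using walk_fourth_moment[of 1 n "f 1"] by (intro mult_left_mono) auto
    also have "\<dots> = ennreal (?K * (1 / real n ^ 2))"
    proof -
      have "1 / real n ^ 4 * (?K * (real n)^2) = ?K * (1 / real n ^ 2)"
        using False by (simp add: power2_eq_square power4_eq_xxxx)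
      then show ?thesis using ennreal_mult'[of "1 / real n ^ 4" "?K * (real n)^2"] by simp
    qed
    finally show ?thesis .
  qed (simp add: Y_def)
  have "(\<integral>\<^sup>+x. (\<Sum>n. ennreal (Y n x)) \<partial>step_space \<nu>) = (\<Sum>n. \<integral>\<^sup>+x. ennreal (Y n x) \<partial>step_space \<nu>)"
    by (intro nn_integral_suminf) measurable
  also have "\<dots> \<le> (\<Sum>n. ennreal (?K * (1 / real n ^ 2)))"
    by (intro suminf_le Y_le) auto
  also have "\<dots> < \<infinity>"
  proof -
    have "summable (\<lambda>n. ?K * (1 / real n ^ 2))"
      using inverse_power_summable[of 2, where 'a = real] by (intro summable_mult) (simp add: divide_inverse)
    then show ?thesis by (subst suminf_ennreal2) simp_all
  qed
  finally have "AE x in step_space \<nu>. (\<Sum>n. ennreal (Y n x)) \<noteq> \<infinity>"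
    by (intro nn_integral_noteq_infinite) auto
  then show ?thesis unfolding has_drift_def
  proof (rule AE_mp, intro AE_I2 impI)
    fix x assume "(\<Sum>n. ennreal (Y n x)) \<noteq> \<infinity>"
    then have "summable (\<lambda>n. Y n x)"
      by (intro summable_suminf_not_top) (auto simp: Y_nonneg)
    then have "(\<lambda>n. Y n x) \<longlonglongrightarrow> 0" by (rule summable_LIMSEQ_zero)
    then have "(\<lambda>n. root 4 (Y n x)) \<longlonglongrightarrow> root 4 0" by (rule tendsto_real_root)
    moreover have "root 4 (Y n x) = \<bar>(f (walk x n) - f 1 - n * c) / n\<bar>" for n
      unfolding Y_def by (subst power_even_abs[symmetric]) (simp_all add: real_root_pos2)
    ultimately have "(\<lambda>n. \<bar>(f (walk x n) - f 1 - n * c) / n\<bar>) \<longlonglongrightarrow> 0"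
      by simp
    then have "(\<lambda>n. (f (walk x n) - f 1 - n * c) / n) \<longlonglongrightarrow> 0"
      by (rule tendsto_rabs_zero_cancel)
    moreover have "(\<lambda>n. f 1 * (1 / n) + c) \<longlonglongrightarrow> f 1 * 0 + c"
      by (intro tendsto_intros lim_1_over_n)
    ultimately have "(\<lambda>n. (f (walk x n) - f 1 - n * c) / n + (f 1 * (1 / n) + c)) \<longlonglongrightarrow> 0 + (f 1 * 0 + c)"
      by (rule tendsto_add)
    moreover have "\<forall>\<^sub>F n in sequentially. (f (walk x n) - f 1 - n * c) / n + (f 1 * (1 / n) + c) = f (walk x n) / n"
      using eventually_gt_at_top[of 0] by eventually_elim (simp add: field_simps)
    ultimately show "(\<lambda>n. f (walk x n) / n) \<longlonglongrightarrow> c"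
      by (simp only: tendsto_cong) simp
  qed
qed

end

section \<open>Arithmetic and uniqueness of drifts\<close>

lemma has_drift_cmult: "has_drift \<nu> f c \<Longrightarrow> has_drift \<nu> (\<lambda>g. r * f g) (r * c)"
  unfolding has_drift_def
  by (erule AE_mp, intro AE_I2 impI) (simp only: times_divide_eq_right[symmetric] tendsto_mult_left)

lemma has_drift_add:
  assumes "has_drift \<nu> f c" "has_drift \<nu> h d"
  shows "has_drift \<nu> (\<lambda>g. f g + h g) (c + d)"
  using assms unfolding has_drift_def
  by eventually_elim (simp only: add_divide_distrib tendsto_add)

lemma has_drift_abs: "has_drift \<nu> f c \<Longrightarrow> has_drift \<nu> (\<lambda>g. \<bar>f g\<bar>) \<bar>c\<bar>"
  unfolding has_drift_def
  by (erule AE_mp, intro AE_I2 impI) (drule tendsto_rabs, simp)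

lemma has_drift_sandwich:
  assumes "has_drift \<nu> f c" "has_drift \<nu> h c" "\<And>g. f g \<le> k g" "\<And>g. k g \<le> h g"
  shows "has_drift \<nu> k c"
  using assms(1,2) unfolding has_drift_def
proof eventually_elim
  case (elim x)
  show ?case
    by (rule tendsto_sandwich[OF _ _ elim]) (auto intro!: always_eventually divide_right_mono assms)
qed

lemma has_drift_bounded:
  assumes "\<And>g. \<bar>f g\<bar> \<le> C"
  shows "has_drift \<nu> f 0"
proof -
  have lim: "(\<lambda>n. C / real n) \<longlonglongrightarrow> 0" for C :: real
    by (rule lim_const_over_n)
  have "- C \<le> f g" "f g \<le> C" for g using assms[of g] by auto
  then have "(\<lambda>n. f (walk x n) / real n) \<longlonglongrightarrow> 0" for x
    by (intro tendsto_sandwich[OF _ _ lim[of "-C"] lim[of C]] always_eventually allI divide_right_mono) auto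
  then show ?thesis by (simp add: has_drift_def)
qed

text \<open>Two drifts are limits along a common path, which exists because the path space has mass
  1.\<close>

lemma drift_eqI:
  assumes "has_drift \<nu> f c"
  shows "drift \<nu> f = c"
  unfolding drift_def
proof (rule the_equality)
  fix d assume d: "has_drift \<nu> f d"
  interpret prob_space "step_space \<nu>" by (rule prob_space_step_space)
  have "AE x in step_space \<nu>. d = c"
    using assms d unfolding has_drift_def by eventually_elim (rule LIMSEQ_unique)
  then show "d = c" by simp
qed (rule assms)

section \<open>The normal form as a stack\<close>

fun flip :: "gen \<Rightarrow> gen" where
  "flip GA = GB"
| "flip GB = GA"

lemma flip_flip [simp]: "flip (flip x) = x"
  by (cases x) simp_all

lemma flip_neq [simp]: "flip x \<noteq> x" "x \<noteq> flip x"
  by (cases x; simp)+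

lemma eq_flip_iff: "flip x = y \<longleftrightarrow> x \<noteq> y" "x = flip y \<longleftrightarrow> x \<noteq> y"
  by (cases x; cases y; simp)+

definition twist :: "int \<Rightarrow> gen \<Rightarrow> gen" where
  "twist k x = (if even k then x else flip x)"

text \<open>A pair \<open>(ts, k)\<close> stands for \<open>rev ts\<close> followed by \<open>\<Delta>\<^sup>k\<close>: right multiplication by a letter
  only affects the head of \<open>ts\<close>. The functions \<open>push_pos\<close> and \<open>push_neg\<close> multiply \<open>rev ts\<close> by
  \<open>y\<close> and \<open>y\<^sup>-\<^sup>1 = flip y \<cdot> y \<cdot> \<Delta>\<^sup>-\<^sup>1\<close>; \<open>twist\<close> moves a letter across \<open>\<Delta>\<^sup>k\<close>.\<close>

fun push_pos :: "gen \<Rightarrow> gen list list \<Rightarrow> int \<Rightarrow> gen list list \<times> int" where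
  "push_pos y [] k = ([[y]], k)"
| "push_pos y (t # ts) k =
    (if last t = y then ([y] # t # ts, k)
     else if length t = 1 then ((t @ [y]) # ts, k)
     else (ts, k + 1))"

fun push_neg :: "gen \<Rightarrow> gen list list \<Rightarrow> int \<Rightarrow> gen list list \<times> int" where
  "push_neg y [] k = ([[flip y, y]], k - 1)"
| "push_neg y (t # ts) k =
    (if last t \<noteq> y then ([flip y, y] # t # ts, k - 1)
     else if length t = 1 then (ts, k)
     else ([hd t] # ts, k))"

fun nf_step :: "letter \<Rightarrow> gen list list \<times> int \<Rightarrow> gen list list \<times> int" where
  "nf_step (x, e) (ts, k) = (if e then push_pos else push_neg) (twist k x) ts k"

text \<open>The head of the list is the top of the stack, hence the rightmost factor, so the
  condition on neighbours appears in reverse order.\<close>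

fun chained :: "gen list list \<Rightarrow> bool" where
  "chained [] = True"
| "chained [t] = (t \<in> garside_T)"
| "chained (t # t' # ts) = (t \<in> garside_T \<and> last t' = hd t \<and> chained (t' # ts))"

lemma chained_Cons:
  "chained (t # ts) \<longleftrightarrow> t \<in> garside_T \<and> (ts = [] \<or> last (hd ts) = hd t) \<and> chained ts"
  by (cases ts) auto

lemma chained_ConsE:
  assumes "chained (t # ts)"
  obtains x where "t = [x]" "ts = [] \<or> last (hd ts) = x" "chained ts"
  | x where "t = [x, flip x]" "ts = [] \<or> last (hd ts) = x" "chained ts"
  using assms by (auto simp: chained_Cons garside_T_def)

lemma in_garside_T_iff [simp]: "[x] \<in> garside_T" "[x, y] \<in> garside_T \<longleftrightarrow> x \<noteq> y"
  by (cases x; cases y; simp add: garside_T_def)+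

lemma twist_simps [simp]:
  "twist (k + 1) x = flip (twist k x)" "twist (k - 1) x = flip (twist k x)" "twist 0 x = x"
  by (simp_all add: twist_def)

lemma twist_flip [simp]: "twist k (flip x) = flip (twist k x)"
  by (simp add: twist_def)

lemma chained_push:
  assumes "chained ts"
  shows "chained (fst (push_pos y ts k))" "chained (fst (push_neg y ts k))"
proof -
  have "chained (fst (push_pos y ts k)) \<and> chained (fst (push_neg y ts k))"
  proof (cases ts)
    case (Cons t r)
    with assms have "chained (t # r)" by simp
    then show ?thesis
      by (cases rule: chained_ConsE) (auto simp: Cons chained_Cons eq_flip_iff)
  qed simp
  then show "chained (fst (push_pos y ts k))" "chained (fst (push_neg y ts k))" by auto
qed

lemma chained_nf_step: "chained (fst s) \<Longrightarrow> chained (fst (nf_step l s))"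
  by (cases l; cases s) (simp add: chained_push)

lemma chained_fold_nf_step: "chained (fst s) \<Longrightarrow> chained (fst (fold nf_step w s))"
  by (induction w arbitrary: s) (auto simp: chained_nf_step)

lemma gen_cases: "x \<noteq> y \<Longrightarrow> x = flip y"
  by (simp add: eq_flip_iff)

section \<open>The group acting on stacks by right multiplication\<close>

lemma nf_step_cancel:
  assumes "chained (fst s)"
  shows "nf_step (x, \<not> e) (nf_step (x, e) s) = s"
proof -
  obtain ts k where s: "s = (ts, k)" by (cases s)
  show ?thesis
  proof (cases ts)
    case Nil
    then show ?thesis by (cases e) (simp_all add: s)
  next
    case (Cons t r)
    with assms s have "chained (t # r)" by simp
    then show ?thesis
      by (cases rule: chained_ConsE; cases r; cases e)
        (auto simp: s Cons eq_flip_iff dest!: gen_cases)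
  qed
qed

text \<open>The result does not depend on \<open>x\<close>, so both sides of the braid relation act
  alike.\<close>

lemma nf_step_Delta:
  assumes "chained ts"
  shows "nf_step (x, True) (nf_step (flip x, True) (nf_step (x, True) (ts, k))) = (ts, k + 1)"
proof (cases ts)
  case (Cons t r)
  with assms have "chained (t # r)" by simp
  then show ?thesis
    by (cases rule: chained_ConsE; cases r) (auto simp: Cons eq_flip_iff dest!: gen_cases)
qed simp

lemma braid_eq_fold_nf_step:
  assumes "braid_eq u v" "chained (fst s)"
  shows "fold nf_step u s = fold nf_step v s"
  using assms
proof (induction arbitrary: s rule: braid_eq.induct)
  case (append u u' v v')
  then show ?case by (simp add: chained_fold_nf_step)
next
  case (cancel x e)
  then show ?case by (simp add: nf_step_cancel)
next
  case braid
  then show ?case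
    using nf_step_Delta[of "fst s" GA "snd s"] nf_step_Delta[of "fst s" GB "snd s"] by simp
qed simp_all

text \<open>A word acts on the empty stack; since the action respects the defining relations, the
  outcome depends only on the group element.\<close>

lift_definition nf_of :: "braid3 \<Rightarrow> gen list list \<times> int" is "\<lambda>w. fold nf_step w ([], 0)"
  by (rule braid_eq_fold_nf_step) simp_all

lift_definition letter_val :: "letter \<Rightarrow> braid3" is "\<lambda>l. [l]" .

lemma letter_val_simps: "letter_val (x, True) = gen_braid x" "letter_val (x, False) = inverse (gen_braid x)"
  by (transfer; simp add: braid_eq.refl)+

lemma nf_of_one [simp]: "nf_of 1 = ([], 0)"
  by transfer simp

lemma nf_of_mult_letter [simp]: "nf_of (g * letter_val l) = nf_step l (nf_of g)"
  by transfer simp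

lemma nf_of_mult_gen: "nf_of (g * gen_braid x) = nf_step (x, True) (nf_of g)"
  using nf_of_mult_letter[of g "(x, True)"] by (simp add: letter_val_simps)

lemma nf_of_gen [simp]: "nf_of (gen_braid x) = ([[x]], 0)"
  using nf_of_mult_gen[of 1 x] by simp

lemma chained_nf_of: "chained (fst (nf_of g))"
  by transfer (simp add: chained_fold_nf_step)

lemma braid3_induct [case_names one letter]:
  assumes "P 1" "\<And>g l. P g \<Longrightarrow> P (g * letter_val l)"
  shows "P g"
proof -
  have "P (abs_braid3 w)" for w
  proof (induction w rule: rev_induct)
    case Nil
    then show ?case using assms(1) by (simp add: one_braid3_def)
  next
    case (snoc l w)
    then show ?case using assms(2)[of "abs_braid3 w" l]
      by (simp add: times_braid3.abs_eq letter_val.abs_eq)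
  qed
  then show ?thesis by (cases g) (metis Quotient3_braid3 Quotient3_abs_rep)
qed

lemma inverse_one_braid3 [simp]: "inverse (1 :: braid3) = 1"
  using braid3_left_inverse[of 1] by simp

lemma braid3_mult_inverse_cancel [simp]:
  "g * inverse g = 1" "inverse g * g = 1"
  "g * (inverse g * h) = h" "inverse g * (g * h) = h" for g h :: braid3
  by (simp_all add: braid3_left_inverse braid3_right_inverse flip: mult.assoc)

lemma braid3_inverse_unique: "g * h = 1 \<Longrightarrow> inverse g = (h :: braid3)"
  by (metis braid3_mult_inverse_cancel(4) mult_1_right)

lemma inverse_mult_braid3: "inverse (g * h) = inverse h * inverse (g :: braid3)"
  by (rule braid3_inverse_unique) (metis braid3_mult_inverse_cancel(1,3) mult.assoc)

lemma powi_add1_braid3: "g powi (k + 1) = g powi k * (g :: braid3)"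
proof (cases "0 \<le> k")
  case True
  then show ?thesis by (simp add: power_int_def nat_add_distrib power_commutes)
next
  case False
  have "inverse g ^ nat (- k) = inverse g ^ Suc (nat (- (k + 1)))"
    using False by (intro arg_cong[of _ _ "\<lambda>n. inverse g ^ n"]) simp
  then have "inverse g ^ nat (- k) * g = inverse g ^ nat (- (k + 1)) * (inverse g * g)"
    by (simp only: power_Suc2 mult.assoc)
  with False show ?thesis by (auto simp: power_int_def)
qed

lemma powi_diff1_braid3: "g powi (k - 1) = g powi k * inverse (g :: braid3)"
  using powi_add1_braid3[of g "k - 1"] by (simp add: mult.assoc)

lemma powi_add_braid3: "g powi (j + k) = g powi j * g powi k" for g :: braid3
proof (induction k rule: int_induct[where k = 0])
  case (step1 i)
  then show ?case by (simp add: powi_add1_braid3 mult.assoc flip: add.assoc)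
next
  case (step2 i)
  then show ?case by (simp add: powi_diff1_braid3 mult.assoc add_diff_eq)
qed simp

section \<open>Conjugation by \<open>br_Delta\<close> and the value of a stack\<close>

lemma Delta_eq: "gen_braid x * gen_braid (flip x) * gen_braid x = br_Delta"
  by (cases x) (simp_all add: br_Delta_def br_Delta_alt br_a_def br_b_def, metis br_Delta_alt br_Delta_def br_a_def br_b_def)

lemma Delta_gen: "br_Delta * gen_braid x = gen_braid (flip x) * br_Delta"
  using Delta_eq[of x] Delta_eq[of "flip x"] by (metis flip_flip mult.assoc)

lemma Delta_powi_gen: "br_Delta powi k * gen_braid x = gen_braid (twist k x) * br_Delta powi k"
proof (induction k arbitrary: x rule: int_induct[where k = 0])
  case (step1 i)
  then show ?case by (simp add: powi_add1_braid3 mult.assoc Delta_gen) (simp flip: mult.assoc)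
next
  case (step2 i)
  have "inverse br_Delta * gen_braid x = gen_braid (flip x) * inverse br_Delta"
    using Delta_gen[of "flip x"] by (metis braid3_mult_inverse_cancel flip_flip mult.assoc mult_1_right)
  with step2 show ?case by (simp add: powi_diff1_braid3 mult.assoc) (simp flip: mult.assoc)
qed simp

lemma Delta_powi_inverse_gen:
  "br_Delta powi k * inverse (gen_braid x) = inverse (gen_braid (twist k x)) * br_Delta powi k"
  using Delta_powi_gen[of k x] by (metis braid3_mult_inverse_cancel mult.assoc mult_1_right)

definition nf_val :: "gen list list \<times> int \<Rightarrow> braid3" where
  "nf_val s = prod_list (map pos_eval (rev (fst s))) * br_Delta powi snd s"

lemma pos_eval_simps [simp]:
  "pos_eval [x] = gen_braid x" "pos_eval [x, y] = gen_braid x * gen_braid y"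
  by (simp_all add: pos_eval_def)

lemma inverse_gen: "inverse (gen_braid x) = gen_braid (flip x) * gen_braid x * inverse br_Delta"
  by (rule braid3_inverse_unique) (simp add: Delta_eq flip: mult.assoc)

lemma nf_val_push_pos:
  assumes "chained ts"
  shows "nf_val (push_pos y ts k) = prod_list (map pos_eval (rev ts)) * gen_braid y * br_Delta powi k"
proof (cases ts)
  case (Cons t r)
  with assms have "chained (t # r)" by simp
  then show ?thesis
  proof (cases rule: chained_ConsE)
    case (1 x)
    then show ?thesis by (auto simp: nf_val_def Cons mult.assoc)
  next
    case (2 x)
    have "gen_braid x * (gen_braid (flip x) * (gen_braid x * br_Delta powi k)) = br_Delta powi (k + 1)"
      by (simp add: Delta_eq add.commute[of k] powi_add_braid3 flip: mult.assoc)
    with 2 show ?thesis by (auto simp: nf_val_def Cons mult.assoc eq_flip_iff)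
  qed
qed (simp add: nf_val_def)

lemma nf_val_push_neg:
  assumes "chained ts"
  shows "nf_val (push_neg y ts k) = prod_list (map pos_eval (rev ts)) * inverse (gen_braid y) * br_Delta powi k"
proof -
  have neg: "gen_braid (flip y) * (gen_braid y * br_Delta powi (k - 1)) = inverse (gen_braid y) * br_Delta powi k" for y
    by (simp add: inverse_gen mult.assoc) (metis add.commute diff_add_cancel powi_add_braid3 power_int_1_right braid3_mult_inverse_cancel(4))
  show ?thesis
  proof (cases ts)
    case (Cons t r)
    with assms have "chained (t # r)" by simp
    then show ?thesis
      by (cases rule: chained_ConsE) (auto simp: nf_val_def Cons mult.assoc neg neg[of "flip _", simplified] eq_flip_iff dest!: gen_cases)
  qed (simp add: nf_val_def neg mult.assoc)
qed

lemma nf_val_nf_step: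
  assumes "chained (fst s)"
  shows "nf_val (nf_step l s) = nf_val s * letter_val l"
proof -
  obtain ts k x e where [simp]: "s = (ts, k)" "l = (x, e)" by (cases s; cases l)
  show ?thesis
    using assms by (cases e) (simp_all add: nf_val_push_pos nf_val_push_neg letter_val_simps
      nf_val_def[of "(ts, k)"] mult.assoc Delta_powi_gen Delta_powi_inverse_gen)
qed

text \<open>Existence of the normal form: steps of the stack correspond to right multiplication by
  letters.\<close>

lemma nf_val_nf_of: "nf_val (nf_of g) = g"
  by (induction g rule: braid3_induct) (simp_all add: nf_val_nf_step chained_nf_of, simp add: nf_val_def)

lemma chained_iff_nth:
  "chained ts \<longleftrightarrow> set ts \<subseteq> garside_T \<and> (\<forall>i. Suc i < length ts \<longrightarrow> last (ts ! Suc i) = hd (ts ! i))"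
proof (induction ts rule: chained.induct)
  case (3 t t' ts)
  show ?case unfolding chained.simps 3
    by (auto simp: nth_Cons' less_Suc_eq_0_disj split: if_splits)
qed auto

lemma is_garside_nf_iff:
  "is_garside_nf g ts k \<longleftrightarrow> chained (rev ts) \<and> g = nf_val (rev ts, k)"
proof -
  have "(\<forall>i. Suc i < length ts \<longrightarrow> last (ts ! i) = hd (ts ! Suc i)) \<longleftrightarrow>
    (\<forall>i. Suc i < length ts \<longrightarrow> last (rev ts ! Suc i) = hd (rev ts ! i))" (is "?L \<longleftrightarrow> ?R")
  proof
    assume ?L
    show ?R
    proof (intro allI impI)
      fix i assume "Suc i < length ts"
      then show "last (rev ts ! Suc i) = hd (rev ts ! i)"
        using \<open>?L\<close>[rule_format, of "length ts - Suc (Suc i)"] by (simp add: rev_nth Suc_diff_Suc)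
    qed
  next
    assume ?R
    show ?L
    proof (intro allI impI)
      fix i assume "Suc i < length ts"
      then show "last (ts ! i) = hd (ts ! Suc i)"
        using \<open>?R\<close>[rule_format, of "length ts - Suc (Suc i)"] by (simp add: rev_nth Suc_diff_Suc)
    qed
  qed
  then show ?thesis by (auto simp: is_garside_nf_def chained_iff_nth nf_val_def)
qed

text \<open>Uniqueness of the normal form: replaying the letters of a chained stack rebuilds it
  factor by factor, because a factor starts with the last letter of the one below, and each
  \<open>br_Delta\<close> then only raises the exponent.\<close>

lemma nf_of_nf_val:
  assumes "chained ts"
  shows "nf_of (nf_val (ts, k)) = (ts, k)"
proof -
  have base: "nf_of (prod_list (map pos_eval (rev ts))) = (ts, 0)" using assms
  proof (induction ts)
    case (Cons t ts)
    then have "nf_of (prod_list (map pos_eval (rev ts))) = (ts, 0)" by (simp add: chained_Cons)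
    with Cons.prems show ?case
      by (cases rule: chained_ConsE; cases ts) (auto simp: nf_of_mult_gen eq_flip_iff simp flip: mult.assoc)
  qed simp
  have Delta: "nf_of (g * br_Delta) = (fst (nf_of g), snd (nf_of g) + 1)" for g
    using nf_step_Delta[OF chained_nf_of[of g], of GA "snd (nf_of g)"]
    by (simp add: nf_of_mult_gen flip: Delta_eq[of GA] mult.assoc)
  have "nf_of (g * br_Delta powi k) = (fst (nf_of g), snd (nf_of g) + k)" for g
  proof (induction k rule: int_induct[where k = 0])
    case (step1 i)
    then show ?case by (simp add: powi_add1_braid3 Delta flip: mult.assoc)
  next
    case (step2 i)
    then show ?case using Delta[of "g * br_Delta powi (i - 1)"]
      by (simp add: mult.assoc flip: powi_add1_braid3) (simp add: prod_eq_iff)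
  qed simp
  then show ?thesis by (simp add: nf_val_def base)
qed

lemma garside_nf_eq: "garside_nf g = (rev (fst (nf_of g)), snd (nf_of g))"
  unfolding garside_nf_def
proof (rule the_equality)
  show "case (rev (fst (nf_of g)), snd (nf_of g)) of (ts, k) \<Rightarrow> is_garside_nf g ts k"
    by (simp add: is_garside_nf_iff chained_nf_of nf_val_nf_of)
  show "z = (rev (fst (nf_of g)), snd (nf_of g))" if "case z of (ts, k) \<Rightarrow> is_garside_nf g ts k" for z
    using that by (cases z) (auto simp: is_garside_nf_iff nf_of_nf_val)
qed

section \<open>Word length against the data of the normal form\<close>

lemma gens_S_eq: "gens_S = range letter_val"
proof -
  have U: "(UNIV :: letter set) = {(GA, True), (GA, False), (GB, True), (GB, False)}"
  proof (intro set_eqI iffI)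
    show "l \<in> {(GA, True), (GA, False), (GB, True), (GB, False)}" for l
      by (cases l; cases "fst l"; cases "snd l") simp_all
  qed simp
  show ?thesis
    unfolding U gens_S_def br_a_def br_b_def by (simp only: letter_val_simps image_insert image_empty)
qed

lemma word_length_le:
  assumes "set xs \<subseteq> S" "prod_list xs = g"
  shows "word_length S g \<le> length xs"
  unfolding word_length_def using assms by (intro Least_le) blast

lemma word_length_attained:
  obtains xs where "set xs \<subseteq> gens_S" "prod_list xs = g" "length xs = word_length gens_S g"
proof -
  have "\<exists>xs. set xs \<subseteq> gens_S \<and> prod_list xs = g"
  proof (induction g rule: braid3_induct)
    case one
    then show ?case by (intro exI[of _ "[]"]) simp
  next
    case (letter g l)
    then obtain xs where "set xs \<subseteq> gens_S" "prod_list xs = g" by blast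
    then show ?case by (intro exI[of _ "xs @ [letter_val l]"]) (simp add: gens_S_eq)
  qed
  then have "\<exists>n xs. set xs \<subseteq> gens_S \<and> length xs = n \<and> prod_list xs = g" by blast
  from LeastI_ex[OF this] show ?thesis using that unfolding word_length_def by blast
qed

lemma hat_length_T_eq: "hat_length_T g = length (fst (nf_of g))"
  by (simp add: hat_length_T_def garside_nf_eq)

lemma hat_length_Splus_eq: "hat_length_Splus g = (\<Sum>t\<leftarrow>fst (nf_of g). length t)"
  by (simp add: hat_length_Splus_def garside_nf_eq rev_map[symmetric] sum_list_rev)

lemma Delta_exponent_eq: "Delta_exponent g = snd (nf_of g)"
  by (simp add: Delta_exponent_def garside_nf_eq)

lemma length_nf_step: "length (fst (nf_step l s)) \<le> Suc (length (fst s))"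
  by (cases l; cases s; cases "fst s") auto

text \<open>The quantity is the image under the abelianization, which sends both generators to 1 and
  \<open>br_Delta\<close> to 3.\<close>

lemma exponent_sum_nf_step:
  assumes "chained (fst s)"
  shows "int (\<Sum>t\<leftarrow>fst (nf_step l s). length t) + 3 * snd (nf_step l s) =
    int (\<Sum>t\<leftarrow>fst s. length t) + 3 * snd s + (if snd l then 1 else - 1)"
proof -
  obtain ts k x e where [simp]: "s = (ts, k)" "l = (x, e)" by (cases s; cases l)
  show ?thesis
  proof (cases ts)
    case (Cons t r)
    with assms have "chained (t # r)" by simp
    then show ?thesis by (cases rule: chained_ConsE) (auto simp: Cons)
  qed simp
qed

text \<open>Each letter adds at most one factor to the stack.\<close>

lemma hat_length_T_le_word_length: "hat_length_T g \<le> word_length gens_S g"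
proof -
  have "hat_length_T (prod_list xs) \<le> length xs" if "set xs \<subseteq> gens_S" for xs
    using that
  proof (induction xs rule: rev_induct)
    case (snoc x xs)
    then obtain l where "x = letter_val l" by (auto simp: gens_S_eq)
    with snoc length_nf_step[of l "nf_of (prod_list xs)"] show ?case
      by (simp add: hat_length_T_eq)
  qed (simp add: hat_length_T_eq)
  moreover obtain xs where "set xs \<subseteq> gens_S" "prod_list xs = g" "length xs = word_length gens_S g"
    by (rule word_length_attained)
  ultimately show ?thesis by metis
qed

text \<open>A long factor \<open>[flip x, x]\<close> is the inverse of \<open>x\<close> times
  \<open>br_Delta\<close>. Collecting all \<open>br_Delta\<close> at the right end only twists
  letters, so each factor costs one generator.\<close>

lemma positive_word_as_generators_Delta:
  assumes "set ts \<subseteq> garside_T"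
  shows "\<exists>xs. set xs \<subseteq> gens_S \<and> length xs = length ts \<and>
    prod_list (map pos_eval ts) = prod_list xs * br_Delta powi (\<Sum>t\<leftarrow>ts. int (length t) - 1)"
  using assms
proof (induction ts rule: rev_induct)
  case (snoc t ts)
  then obtain xs where xs: "set xs \<subseteq> gens_S" "length xs = length ts"
    "prod_list (map pos_eval ts) = prod_list xs * br_Delta powi (\<Sum>t\<leftarrow>ts. int (length t) - 1)" by auto
  let ?k = "\<Sum>t\<leftarrow>ts. int (length t) - 1"
  have "\<exists>l. pos_eval t = letter_val l * br_Delta powi (int (length t) - 1)"
  proof -
    from snoc.prems consider x where "t = [x]" | x where "t = [flip x, x]"
      by (auto simp: garside_T_def)
    then show ?thesis
    proof cases
      case (1 x)
      then show ?thesis by (intro exI[of _ "(x, True)"]) (simp add: letter_val_simps)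
    next
      case (2 x)
      then show ?thesis
        by (intro exI[of _ "(x, False)"])
          (simp add: letter_val_simps mult.assoc flip: Delta_eq[of x])
    qed
  qed
  then obtain y e where l: "pos_eval t = letter_val (y, e) * br_Delta powi (int (length t) - 1)" by auto
  have "br_Delta powi ?k * letter_val (y, e) = letter_val (twist ?k y, e) * br_Delta powi ?k"
    by (cases e) (simp_all add: letter_val_simps Delta_powi_gen Delta_powi_inverse_gen)
  then have "prod_list (map pos_eval (ts @ [t])) =
      prod_list (xs @ [letter_val (twist ?k y, e)]) * br_Delta powi (?k + (int (length t) - 1))"
    by (simp add: xs l powi_add_braid3 mult.assoc) (simp flip: mult.assoc)
  then show ?case using xs(1,2)
    by (intro exI[of _ "xs @ [letter_val (twist ?k y, e)]"]) (simp add: gens_S_eq)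
qed simp

lemma Delta_powi_word: "\<exists>xs. set xs \<subseteq> gens_S \<and> length xs = 3 * nat \<bar>k\<bar> \<and> prod_list xs = br_Delta powi k"
proof -
  have power: "\<exists>xs. set xs \<subseteq> gens_S \<and> length xs = 3 * n \<and> prod_list xs = g ^ n"
    if "set ys \<subseteq> gens_S" "length ys = 3" "prod_list ys = g" for ys g n
  proof (induction n)
    case (Suc n)
    then obtain xs where "set xs \<subseteq> gens_S" "length xs = 3 * n" "prod_list xs = g ^ n" by blast
    with that show ?case by (intro exI[of _ "ys @ xs"]) simp
  qed simp
  have "\<exists>xs. set xs \<subseteq> gens_S \<and> length xs = 3 * n \<and> prod_list xs = br_Delta ^ n" for n
    by (rule power[of "[br_a, br_b, br_a]"]) (simp_all add: gens_S_def br_Delta_def mult.assoc)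
  moreover have "\<exists>xs. set xs \<subseteq> gens_S \<and> length xs = 3 * n \<and> prod_list xs = inverse br_Delta ^ n" for n
    by (rule power[of "[inverse br_a, inverse br_b, inverse br_a]"])
      (simp_all add: gens_S_def br_Delta_def mult.assoc inverse_mult_braid3)
  ultimately show ?thesis
    by (cases "0 \<le> k") (simp_all add: power_int_def)
qed

text \<open>Each long factor releases one \<open>br_Delta\<close>. What remains after combining
  these with the exponent is spelled with three letters per \<open>br_Delta\<close>.\<close>

lemma word_length_upper_bound:
  "int (word_length gens_S g) \<le> int (hat_length_T g)
    + 3 * \<bar>int (hat_length_Splus g) - int (hat_length_T g) + Delta_exponent g\<bar>"
proof -
  obtain ts k where nf: "garside_nf g = (ts, k)" by (cases "garside_nf g")
  have "is_garside_nf g ts k"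
    using nf chained_nf_of[of g] by (auto simp: garside_nf_eq is_garside_nf_iff nf_val_nf_of)
  then have ts: "set ts \<subseteq> garside_T" and g: "g = prod_list (map pos_eval ts) * br_Delta powi k"
    by (auto simp: is_garside_nf_def)
  let ?m = "\<Sum>t\<leftarrow>ts. int (length t) - 1"
  obtain xs where xs: "set xs \<subseteq> gens_S" "length xs = length ts"
    "prod_list (map pos_eval ts) = prod_list xs * br_Delta powi ?m"
    using positive_word_as_generators_Delta[OF ts] by blast
  obtain ys where ys: "set ys \<subseteq> gens_S" "length ys = 3 * nat \<bar>?m + k\<bar>" "prod_list ys = br_Delta powi (?m + k)"
    using Delta_powi_word[of "?m + k"] by blast
  have "g = prod_list (xs @ ys)" by (simp add: g xs ys powi_add_braid3 mult.assoc)
  then have "word_length gens_S g \<le> length (xs @ ys)"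
    using xs ys by (intro word_length_le) auto
  then have "int (word_length gens_S g) \<le> int (length xs) + int (length ys)" by simp
  moreover have "?m = int (\<Sum>t\<leftarrow>ts. length t) - int (length ts)"
    by (induction ts) auto
  ultimately show ?thesis
    using xs(2) ys(2) by (simp add: hat_length_T_def hat_length_Splus_def Delta_exponent_def nf)
qed

lemma step_law_expectation:
  assumes "0 \<le> p" "p \<le> 1/2"
  shows "measure_pmf.expectation (step_law p) f =
    p * f (letter_val (GA, True)) + p * f (letter_val (GA, False)) +
    (1/2 - p) * f (letter_val (GB, True)) + (1/2 - p) * f (letter_val (GB, False))"
    and "set_pmf (step_law p) \<subseteq> gens_S"
proof -
  let ?xs = "[(br_a, p), (inverse br_a, p), (br_b, 1/2 - p), (inverse br_b, 1/2 - p)]"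
  have wf: "pmf_of_list_wf ?xs" using assms by (auto simp: pmf_of_list_wf_def)
  have letters: "br_a = letter_val (GA, True)" "inverse (letter_val (GA, True)) = letter_val (GA, False)"
    "br_b = letter_val (GB, True)" "inverse (letter_val (GB, True)) = letter_val (GB, False)"
    by (simp_all add: br_a_def br_b_def letter_val_simps)
  \<comment> \<open>The four letters are told apart by their normal forms, so no two weights of the
    list fall on the same element.\<close>
  have "nf_of (letter_val l) = nf_step l ([], 0)" for l
    using nf_of_mult_letter[of 1 l] by simp
  then have inj: "letter_val l = letter_val l' \<Longrightarrow> nf_step l ([], 0) = nf_step l' ([], 0)" for l l'
    by metis
  have neq: "letter_val (x, e) = letter_val (x', e') \<longleftrightarrow> (x, e) = (x', e')" for x e x' e'
    using inj[of "(x, e)" "(x', e')"] by (cases x; cases x'; cases e; cases e') auto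
  show sub: "set_pmf (step_law p) \<subseteq> gens_S"
    using set_pmf_of_list[OF wf] by (auto simp: step_law_def gens_S_def)
  have "measure_pmf.expectation (step_law p) f = (\<Sum>s\<in>gens_S. f s * pmf (step_law p) s)"
    by (rule integral_measure_pmf_real) (use sub in \<open>auto simp: gens_S_def\<close>)
  then show "measure_pmf.expectation (step_law p) f =
    p * f (letter_val (GA, True)) + p * f (letter_val (GA, False)) +
    (1/2 - p) * f (letter_val (GB, True)) + (1/2 - p) * f (letter_val (GB, False))"
    unfolding step_law_def pmf_pmf_of_list[OF wf] unfolding gens_S_def letters by (simp add: neq)
qed

section \<open>The traffic equations\<close>

text \<open>Let \<open>\<xi>\<close> be a random boundary point that can interact with the top factor of \<open>g\<close>. In a class of
  factors with removal probabilities \<open>x, y\<close>, \<open>layer x y w v K L\<close> is the mean of the weighted length of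
  \<open>g\<xi>\<close> minus those of \<open>g\<close> and \<open>\<xi>\<close>: the top factor has weight \<open>w\<close>, the other kind of factor weight \<open>v\<close>;
  with probability \<open>1 - x - y\<close> two equal factors merge into one of the other kind, and otherwise they
  cancel, which leaves the mean \<open>K\<close> or \<open>L\<close> of the rest of the stack.\<close>

definition layer :: "real \<Rightarrow> real \<Rightarrow> real \<Rightarrow> real \<Rightarrow> real \<Rightarrow> real \<Rightarrow> real" where
  "layer x y w v K L = - (2 - (x + y)) * w + (1 - 2 * (x + y)) * v + x * K + y * L"

text \<open>The four summands are the four steps seen from a top factor of weight \<open>w\<close>:
  it is removed, it changes its kind, a factor of its kind is put on it, or one of the other kind.
  The two sides differ by a linear combination of the equations for \<open>x\<close> and
  \<open>y\<close>.\<close>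

lemma layer_mean:
  assumes "p + q = 1/2" and "x + y + x' + y' = 1"
    and x: "x = p + q * y + p * (x * x + y * y') + q * (x' * x + y' * y')"
    and y: "y = q * x + p * (x * y + y * x') + q * (x' * y + y' * x')"
  shows "p * (f + K / 2) + q * (f + v + layer x y v w L K / 2)
      + p * (f + w + w + layer x y w v (layer x y w v K L) (layer x' y' w v L K) / 2)
      + q * (f + w + v + layer x' y' v w (layer x y w v K L) (layer x' y' w v L K) / 2)
    = f + w + layer x y w v K L / 2 + (p * (x' + y') + q * (x + y)) * (w + v) / 2" (is "?l = ?r")
proof -
  have q: "q = 1/2 - p" and y': "y' = 1 - x - y - x'" using assms by auto
  have "?l - ?r = (K / 2 + w / 2 - v) * (p + q * y + p * (x * x + y * y') + q * (x' * x + y' * y') - x)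
    + (L / 2 + w / 2 - v) * (q * x + p * (x * y + y * x') + q * (x' * y + y' * x') - y)"
    unfolding q y' layer_def by (simp add: field_simps)
  also have "\<dots> = 0" using x y by simp
  finally show ?thesis by simp
qed

definition wlen :: "real \<Rightarrow> real \<Rightarrow> gen list list \<Rightarrow> real" where
  "wlen w v ts = (\<Sum>t\<leftarrow>ts. if length t = 1 then w else v)"

lemma wlen_simps [simp]:
  "wlen w v [] = 0"
  "wlen w v (t # ts) = (if length t = 1 then w else v) + wlen w v ts"
  by (simp_all add: wlen_def)

lemma wlen_nf_step: "\<bar>wlen w v (fst (nf_step l s)) - wlen w v (fst s)\<bar> \<le> \<bar>w\<bar> + \<bar>v\<bar>"
  by (cases l; cases s; cases "fst s") auto

locale traffic =
  fixes p q x y x' y' :: real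
  assumes p_nonneg: "0 \<le> p" and q_nonneg: "0 \<le> q" and p_plus_q: "p + q = 1/2"
    and total: "x + y + x' + y' = 1"
    and x_eq: "x = p + q * y + p * (x * x + y * y') + q * (x' * x + y' * y')"
    and y_eq: "y = q * x + p * (x * y + y * x') + q * (x' * y + y' * x')"
    and x'_eq: "x' = q + p * y' + q * (x' * x' + y' * y) + p * (x * x' + y * y)"
    and y'_eq: "y' = p * x' + q * (x' * y' + y' * x) + p * (x * y' + y * x)"
    and contraction: "\<bar>x\<bar> + \<bar>y\<bar> < 1" "\<bar>x'\<bar> + \<bar>y'\<bar> < 1"
begin

text \<open>The mean increment obtained below is \<open>speed * (w + v) / 2\<close>, so this is the
  drift of the number of factors.\<close>

definition speed :: real where
  "speed = p * (x' + y') + q * (x + y)"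

text \<open>\<open>c\<close> tells whether the factor is removed by a power of \<open>a\<close> or
  by one of \<open>b\<close>.\<close>

definition level :: "bool \<Rightarrow> real \<Rightarrow> real \<Rightarrow> real \<Rightarrow> real \<Rightarrow> real" where
  "level c = (if c then layer x y else layer x' y')"

lemma level_mean:
  assumes "P = (if c then p else q)" "Q = (if c then q else p)"
  shows "P * (f + K / 2) + Q * (f + v + level c v w L K / 2)
      + P * (f + w + w + level c w v (level c w v K L) (level (\<not> c) w v L K) / 2)
      + Q * (f + w + v + level (\<not> c) v w (level c w v K L) (level (\<not> c) w v L K) / 2)
    = f + w + level c w v K L / 2 + speed * (w + v) / 2"
proof (cases c)
  case True
  with layer_mean[OF p_plus_q total x_eq y_eq] assms show ?thesis
    by (simp add: level_def speed_def)
next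
  case False
  have "q + p = 1/2" "x' + y' + x + y = 1" using p_plus_q total by auto
  from False layer_mean[OF this x'_eq y'_eq, of f K v w L] assms show ?thesis
    by (simp add: level_def speed_def add.commute[of "q * (x + y)"])
qed

text \<open>\<open>e\<close> is the parity of the exponent of \<Delta>, which together with the
  first letter determines the class of the factor. Removing a long factor completes a \<Delta> and
  changes the parity; hence the exchange of \<open>e\<close> and \<open>\<not> e\<close> in the
  second case.\<close>

fun pot :: "real \<Rightarrow> real \<Rightarrow> bool \<Rightarrow> gen list list \<Rightarrow> real" where
  "pot w v e [] = 0"
| "pot w v e (t # ts) =
    (if length t = 1
     then level ((hd t = GA) \<noteq> e) w v (pot w v e ts) (pot w v (\<not> e) ts)
     else level ((hd t = GA) \<noteq> e) v w (pot w v (\<not> e) ts) (pot w v e ts))"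

text \<open>The factor 1/2 is the probability that a boundary point interacts with the top
  factor.\<close>

definition harm :: "real \<Rightarrow> real \<Rightarrow> gen list list \<times> int \<Rightarrow> real" where
  "harm w v s = wlen w v (fst s) + pot w v (odd (snd s)) (fst s) / 2"

lemma harm_mean:
  assumes "chained (fst s)"
  shows "p * harm w v (nf_step (GA, True) s) + p * harm w v (nf_step (GA, False) s)
    + q * harm w v (nf_step (GB, True) s) + q * harm w v (nf_step (GB, False) s)
    = harm w v s + speed * (w + v) / 2"
proof -
  obtain ts k where s: "s = (ts, k)" by (cases s)
  show ?thesis
  proof (cases ts)
    case Nil
    have q: "q = 1/2 - p" and y': "y' = 1 - x - y - x'" using p_plus_q total by auto
    show ?thesis
      by (simp add: s Nil harm_def twist_def level_def layer_def speed_def)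
        (simp add: q y' field_simps)
  next
    case (Cons t r)
    with assms s have "chained (t # r)" by simp
    then show ?thesis
    proof (cases rule: chained_ConsE)
      case (1 z)
      define c where "c = ((z = GA) \<noteq> odd k)"
      show ?thesis
        using level_mean[OF HOL.refl HOL.refl, of c "wlen w v r" "pot w v (odd k) r" v w "pot w v (even k) r"]
        by (cases z; cases "odd k"; cases c)
          (simp_all add: s Cons 1 harm_def twist_def c_def algebra_simps)
    next
      case (2 z)
      define c where "c = ((z = GA) \<noteq> odd k)"
      show ?thesis
        \<comment> \<open>For a long top factor the two weights exchange roles, and so do the two
          parities.\<close>
        using level_mean[OF HOL.refl HOL.refl, of c "wlen w v r" "pot w v (even k) r" w v "pot w v (odd k) r"] 2(2)
        by (cases z; cases "odd k"; cases c; cases r)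
          (simp_all add: s Cons 2 harm_def twist_def c_def algebra_simps)
    qed
  qed
qed

text \<open>Each level adds a bounded amount and damps the contribution of the lower levels by a
  factor \<rho> < 1.\<close>

lemma pot_bounded: "\<exists>M. \<forall>e ts. \<bar>pot w v e ts\<bar> \<le> M"
proof -
  define \<rho> where "\<rho> = max (\<bar>x\<bar> + \<bar>y\<bar>) (\<bar>x'\<bar> + \<bar>y'\<bar>)"
  define N where "N = 5 * (\<bar>w\<bar> + \<bar>v\<bar>)"
  have \<rho>: "\<rho> < 1" using contraction by (simp add: \<rho>_def)
  have N: "0 \<le> N" by (simp add: N_def)
  have layer: "\<bar>layer X Y a b K L\<bar> \<le> 5 * (\<bar>a\<bar> + \<bar>b\<bar>) + \<rho> * M"
    if "\<bar>X\<bar> + \<bar>Y\<bar> \<le> \<rho>" "\<bar>K\<bar> \<le> M" "\<bar>L\<bar> \<le> M" for X Y a b K L M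
  proof -
    have XY: "\<bar>X + Y\<bar> \<le> 1" and M: "0 \<le> M" using that \<rho> by linarith+
    have "\<bar>- (2 - (X + Y)) * a\<bar> \<le> 5 * \<bar>a\<bar>" "\<bar>(1 - 2 * (X + Y)) * b\<bar> \<le> 5 * \<bar>b\<bar>"
      using XY by (auto simp: abs_mult intro!: mult_right_mono)
    moreover have "\<bar>X * K\<bar> \<le> \<bar>X\<bar> * M" "\<bar>Y * L\<bar> \<le> \<bar>Y\<bar> * M"
      using that by (auto simp: abs_mult intro!: mult_left_mono)
    moreover have "(\<bar>X\<bar> + \<bar>Y\<bar>) * M \<le> \<rho> * M" using that M by (intro mult_right_mono)
    ultimately show ?thesis unfolding layer_def by (simp add: ring_distribs) linarith
  qed
  have level: "\<bar>level c a b K L\<bar> \<le> 5 * (\<bar>a\<bar> + \<bar>b\<bar>) + \<rho> * M" if "\<bar>K\<bar> \<le> M" "\<bar>L\<bar> \<le> M" for c a b K L M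
  proof -
    have "\<bar>x\<bar> + \<bar>y\<bar> \<le> \<rho>" "\<bar>x'\<bar> + \<bar>y'\<bar> \<le> \<rho>" by (simp_all add: \<rho>_def)
    then show ?thesis using that by (cases c) (simp_all only: level_def layer if_True if_False)
  qed
  \<comment> \<open>The fixed point of the recursive bound.\<close>
  let ?M = "N / (1 - \<rho>)"
  have M: "N + \<rho> * ?M = ?M" using \<rho> by (simp add: field_simps)
  have "\<bar>pot w v e ts\<bar> \<le> ?M" for e ts
  proof (induction ts arbitrary: e)
    case Nil
    then show ?case using \<rho> N by simp
  next
    case (Cons t ts)
    note IH = Cons[of e] Cons[of "\<not> e"]
    have "\<bar>pot w v e (t # ts)\<bar> \<le> N + \<rho> * ?M"
      using level[OF IH, of "(hd t = GA) \<noteq> e" w v] level[OF IH(2,1), of "(hd t = GA) \<noteq> e" v w]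
      by (simp add: N_def add.commute)
    then show ?case by (simp only: M)
  qed
  then show ?thesis by blast
qed

lemma p_bounds: "0 \<le> p" "p \<le> 1/2" and q_eq: "1/2 - p = q"
  using p_nonneg q_nonneg p_plus_q by auto

text \<open>\<open>harm\<close> has constant mean increment and differs from the weighted length by
  a bounded term, which has drift 0.\<close>

lemma has_drift_wlen: "has_drift (step_law p) (\<lambda>g. wlen w v (fst (nf_of g))) (speed * (w + v) / 2)"
proof -
  obtain M where M: "\<And>e ts. \<bar>pot w v e ts\<bar> \<le> M" using pot_bounded by blast
  have "has_drift (step_law p) (\<lambda>g. harm w v (nf_of g)) (speed * (w + v) / 2)"
  proof (rule has_drift_of_mean_increment)
    show "measure_pmf.expectation (step_law p) (\<lambda>s. harm w v (nf_of (g * s))) =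
        harm w v (nf_of g) + speed * (w + v) / 2" for g
      using harm_mean[OF chained_nf_of, of w v g]
      by (simp add: step_law_expectation[OF p_bounds] q_eq)
    show "\<bar>harm w v (nf_of (g * s)) - harm w v (nf_of g)\<bar> \<le> \<bar>w\<bar> + \<bar>v\<bar> + M"
      if s: "s \<in> set_pmf (step_law p)" for g s
    proof -
      obtain l where l: "s = letter_val l"
        using subsetD[OF step_law_expectation(2)[OF p_bounds] s] unfolding gens_S_eq by blast
      show ?thesis
        using wlen_nf_step[of w v l "nf_of g"]
          M[of "odd (snd (nf_step l (nf_of g)))" "fst (nf_step l (nf_of g))"]
          M[of "odd (snd (nf_of g))" "fst (nf_of g)"]
        unfolding l nf_of_mult_letter harm_def by (simp only: abs_le_iff) linarith
    qed
  qed
  moreover have "has_drift (step_law p) (\<lambda>g. - pot w v (odd (snd (nf_of g))) (fst (nf_of g)) / 2) 0"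
    using M by (intro has_drift_bounded[of _ "M / 2"]) simp
  ultimately have "has_drift (step_law p)
      (\<lambda>g. harm w v (nf_of g) + - pot w v (odd (snd (nf_of g))) (fst (nf_of g)) / 2)
      (speed * (w + v) / 2 + 0)"
    by (rule has_drift_add)
  then show ?thesis by (simp add: harm_def)
qed

lemma has_drift_len_T: "has_drift (step_law p) len_T speed"
proof -
  have "wlen 1 1 ts = real (length ts)" for ts by (induction ts) auto
  then show ?thesis using has_drift_wlen[of 1 1] by (simp add: hat_length_T_eq)
qed

lemma has_drift_len_Splus: "has_drift (step_law p) len_Splus (3/2 * speed)"
proof -
  have "chained ts \<Longrightarrow> wlen 1 2 ts = real (\<Sum>t\<leftarrow>ts. length t)" for ts
    by (induction ts) (auto simp: chained_Cons garside_T_def)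
  then show ?thesis
    using has_drift_wlen[of 1 2] chained_nf_of by (simp add: hat_length_Splus_eq mult.commute)
qed

text \<open>The exponent sum moves by 1 or -1 with equal probability, so it has drift 0.\<close>

lemma has_drift_exp_Delta: "has_drift (step_law p) exp_Delta (- speed / 2)"
proof -
  let ?f = "\<lambda>g. len_Splus g + 3 * exp_Delta g"
  have step: "?f (g * letter_val l) = ?f g + (if snd l then 1 else - 1)" for g l
    using exponent_sum_nf_step[OF chained_nf_of, of l g, THEN arg_cong[of _ _ real_of_int]]
    by (simp add: hat_length_Splus_eq Delta_exponent_eq split: if_splits)
  have "has_drift (step_law p) ?f 0"
  proof (rule has_drift_of_mean_increment)
    show "measure_pmf.expectation (step_law p) (\<lambda>s. ?f (g * s)) = ?f g + 0" for g
      unfolding step_law_expectation[OF p_bounds] step by (simp add: algebra_simps)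
    show "\<bar>?f (g * s) - ?f g\<bar> \<le> 1" if s: "s \<in> set_pmf (step_law p)" for g s
    proof -
      obtain l where "s = letter_val l"
        using subsetD[OF step_law_expectation(2)[OF p_bounds] s] unfolding gens_S_eq by blast
      then show ?thesis using step[of g l] by simp
    qed
  qed
  from has_drift_cmult[OF has_drift_add[OF this has_drift_cmult[OF has_drift_len_Splus, of "-1"]], of "1/3"]
  show ?thesis by simp
qed

lemma has_drift_len_S: "has_drift (step_law p) len_S speed"
proof (rule has_drift_sandwich[OF has_drift_len_T])
  \<comment> \<open>The number of long factors plus the exponent of \<Delta>; its drift is
    \<open>3/2 - 1 - 1/2 = 0\<close> times the speed.\<close>
  let ?e = "\<lambda>g. 1 * len_Splus g + (-1 * len_T g + exp_Delta g)"
  let ?h = "\<lambda>g. len_T g + 3 * \<bar>?e g\<bar>"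
  have "has_drift (step_law p) ?e (1 * (3/2 * speed) + (-1 * speed + (- speed / 2)))"
    by (intro has_drift_add has_drift_cmult has_drift_len_Splus has_drift_len_T has_drift_exp_Delta)
  then have "has_drift (step_law p) ?e 0" by simp
  from has_drift_add[OF has_drift_len_T has_drift_cmult[OF has_drift_abs[OF this], of 3]]
  show "has_drift (step_law p) ?h speed" by simp
  show "len_S g \<le> ?h g" for g
    using word_length_upper_bound[of g, THEN of_int_le_iff[where 'a = real, THEN iffD2]] by (simp add: algebra_simps)
qed (simp add: hat_length_T_le_word_length)

end

section \<open>Solving the traffic equations\<close>

text \<open>The system is symmetric under the exchange of the two generators.\<close>

lemma traffic_swap:
  assumes "traffic p q x y x' y'"
  shows "traffic q p x' y' x y"
proof -
  interpret traffic p q x y x' y' by fact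
  show ?thesis
    using p_nonneg q_nonneg p_plus_q total contraction x_eq y_eq x'_eq y'_eq
    by (intro traffic.intro) (auto simp: add.commute)
qed

text \<open>With \<open>p x + q x' = 1/2 - g - B\<close> and \<open>p y + q y' = B\<close> the traffic equations become linear, and
  they decouple in \<open>r = x + y\<close>, \<open>d = x - y\<close>, \<open>d' = x' - y'\<close>.\<close>

lemma traffic_of_linear_system:
  fixes p q r B d d' :: real
  assumes pq: "0 < p" "0 < q" "p + q = 1/2" and r: "0 < r" "r < 1" and B: "0 \<le> B"
    and g: "g = p + (q - p) * r"
    and B_eq: "(1 - 2 * r) * B = (q - p) * r\<^sup>2 + 2 * p * r - p"
    and d: "(1/2 + g + B + q) * d + B * d' = p"
    and d': "B * d + (1/2 + g + B + p) * d' = q"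
    and consistent: "p * d + q * d' = 1/2 - g - 2 * B"
  shows "traffic p q ((r + d) / 2) ((r - d) / 2) ((1 - r + d') / 2) ((1 - r - d') / 2)"
proof -
  define x y x' y' where "x = (r + d) / 2" and "y = (r - d) / 2"
    and "x' = (1 - r + d') / 2" and "y' = (1 - r - d') / 2"
  note defs = this
  have "g = p * (1 - r) + q * r" by (simp add: g algebra_simps)
  then have g0: "0 < g" using pq r by (simp add: add_pos_pos)
  have mass: "p * r + q * (1 - r) = 1/2 - g" unfolding g using pq(3) by (simp add: algebra_simps)
  have P: "p * x + q * x' = 1/2 - g - B"
  proof -
    have "p * x + q * x' = (p * r + q * (1 - r) + (p * d + q * d')) / 2" by (simp add: defs field_simps)
    then show ?thesis by (simp add: mass consistent)
  qed
  have Q: "p * y + q * y' = B"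
  proof -
    have "p * y + q * y' = (p * r + q * (1 - r) - (p * d + q * d')) / 2" by (simp add: defs field_simps)
    then show ?thesis by (simp add: mass consistent)
  qed
  have q: "q = 1/2 - p" using pq by simp
  have sum: "(1/2 + g + B) * r = p + q * r + B * (1 - r)"
    using B_eq unfolding g q by (simp add: power2_eq_square field_simps)
  have sum': "(1/2 + g + B) * (1 - r) = q + p * (1 - r) + B * r"
    using sum unfolding g q by (simp add: field_simps)
  \<comment> \<open>The four equations are half sums and half differences of \<open>sum\<close>,
    \<open>sum'\<close> and the equations for \<open>d\<close>, \<open>d'\<close>.\<close>
  have x: "x = p + q * y + x * (p * x + q * x') + y' * (p * y + q * y')"
    unfolding P Q unfolding defs using sum d by (simp add: field_simps)
  have y: "y = q * x + y * (p * x + q * x') + x' * (p * y + q * y')"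
    unfolding P Q unfolding defs using sum d by (simp add: field_simps)
  have x': "x' = q + p * y' + x' * (p * x + q * x') + y * (p * y + q * y')"
    unfolding P Q unfolding defs using sum' d' by (simp add: field_simps)
  have y': "y' = p * x' + y' * (p * x + q * x') + x * (p * y + q * y')"
    unfolding P Q unfolding defs using sum' d' by (simp add: field_simps)
  \<comment> \<open>In the row of the larger unknown the two terms with \<open>B\<close> cancel in
    the estimate, leaving a coefficient above 1/2 against a right side below 1/2.\<close>
  have dominant: "\<bar>e\<bar> < 1"
    if "(1/2 + g + B + s) * e + B * e' = t" "\<bar>e'\<bar> \<le> \<bar>e\<bar>" "0 < s" "0 < t" "t < 1/2" for e e' s t
  proof -
    have "(1/2 + g + B + s) * \<bar>e\<bar> = \<bar>t - B * e'\<bar>"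
      using that g0 B by (simp add: abs_mult flip: that(1))
    also have "\<dots> \<le> t + B * \<bar>e\<bar>"
      using that(2,4) B abs_triangle_ineq4[of t "B * e'"] mult_left_mono[OF that(2) B] by (simp add: abs_mult)
    finally have "(1/2 + g + s) * \<bar>e\<bar> \<le> t" by (simp add: algebra_simps)
    moreover have "1/2 * \<bar>e\<bar> \<le> (1/2 + g + s) * \<bar>e\<bar>" using that g0 by (intro mult_right_mono) auto
    ultimately show ?thesis using that by simp
  qed
  have "\<bar>d\<bar> < 1 \<and> \<bar>d'\<bar> < 1"
  proof (cases "\<bar>d'\<bar> \<le> \<bar>d\<bar>")
    case True
    then have "\<bar>d\<bar> < 1" using pq by (intro dominant[OF d]) auto
    with True show ?thesis by simp
  next
    case False
    have "(1/2 + g + B + p) * d' + B * d = q" using d' by simp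
    from dominant[OF this] have "\<bar>d'\<bar> < 1" using False pq by simp
    with False show ?thesis by simp
  qed
  \<comment> \<open>\<open>\<bar>x\<bar> + \<bar>y\<bar>\<close> is the larger of
    \<open>\<bar>x + y\<bar>\<close> and \<open>\<bar>x - y\<bar>\<close>.\<close>
  moreover have "x + y = r" "x - y = d" "x' + y' = 1 - r" "x' - y' = d'"
    by (simp_all add: defs field_simps)
  ultimately have contraction: "\<bar>x\<bar> + \<bar>y\<bar> < 1" "\<bar>x'\<bar> + \<bar>y'\<bar> < 1" using r by linarith+
  have expand: "s * (p * x + q * x') + t * (p * y + q * y')
      = p * (x * s + y * t) + q * (x' * s + y' * t)" for s t
    by (simp add: algebra_simps)
  have "traffic p q x y x' y'"
  proof
    show "x + y + x' + y' = 1" by (simp add: defs field_simps)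
    show "x = p + q * y + p * (x * x + y * y') + q * (x' * x + y' * y')"
      using x expand[of x y'] by linarith
    show "y = q * x + p * (x * y + y * x') + q * (x' * y + y' * x')"
      using y expand[of y x'] by linarith
    show "x' = q + p * y' + q * (x' * x' + y' * y) + p * (x * x' + y * y)"
      using x' expand[of x' y] by linarith
    show "y' = p * x' + q * (x' * y' + y' * x) + p * (x * y' + y * x)"
      using y' expand[of y' x] by linarith
  qed (use pq contraction in auto)
  then show ?thesis by (simp only: defs)
qed

text \<open>The difference of both sides is quadratic in \<open>B\<close>; times \<open>(2 (q - p))\<^sup>2\<close> it becomes a polynomial in
  \<open>p, r\<close> that is divisible by the cubic. The quotient is the long factor in the proof.\<close>

lemma consistency_of_cubic:
  fixes p q r B :: real
  assumes q: "q = 1/2 - p" and "p \<noteq> q" and g: "g = p + (q - p) * r" and h: "h = 1/2 + g"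
    and N: "N = (q - p) * r\<^sup>2 + 2 * p * r - p"
    and B: "2 * (q - p) * B = 4 * p * q * (1 - 2 * r) - N"
    and cubic: "N * (2 * q - r) = 2 * p * q * (1 - 2 * r)\<^sup>2"
  shows "(1/2 - g - 2 * B) * ((h + B + q) * (h + B + p) - B\<^sup>2)
    = p * (p * (h + B + p) - q * B) + q * (q * (h + B + q) - p * B)"
proof -
  \<comment> \<open>Coefficients in powers of \<open>B\<close>: the determinant
    \<open>(h + B + q) * (h + B + p) - B\<^sup>2\<close> is linear in \<open>B\<close>, so the
    degree is only 2.\<close>
  define \<alpha> where "\<alpha> = (1/2 - g) * (h + q) * (h + p) - (p\<^sup>2 * (h + p) + q\<^sup>2 * (h + q))"
  define \<beta> where "\<beta> = (1/2 - g) * (2 * h + 1/2) - 2 * (h + q) * (h + p) - (p\<^sup>2 + q\<^sup>2 - 2 * p * q)"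
  define \<gamma> where "\<gamma> = - 2 * (2 * h + 1/2)"
  define M where "M = 4 * p * q * (1 - 2 * r) - N"
  let ?E = "(1/2 - g - 2 * B) * ((h + B + q) * (h + B + p) - B\<^sup>2)
    - (p * (p * (h + B + p) - q * B) + q * (q * (h + B + q) - p * B))"
  have E: "?E = \<alpha> + \<beta> * B + \<gamma> * B\<^sup>2"
    unfolding \<alpha>_def \<beta>_def \<gamma>_def q by (simp add: field_simps power2_eq_square)
  have "(2 * (q - p))\<^sup>2 * (\<alpha> + \<beta> * B + \<gamma> * B\<^sup>2)
      = (2 * (q - p))\<^sup>2 * \<alpha> + 2 * (q - p) * \<beta> * (2 * (q - p) * B) + \<gamma> * (2 * (q - p) * B)\<^sup>2"
    by (simp add: algebra_simps power2_eq_square)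
  also have "\<dots> = (2 * (q - p))\<^sup>2 * \<alpha> + 2 * (q - p) * \<beta> * M + \<gamma> * M\<^sup>2"
    by (simp only: B M_def)
  also have "\<dots> = (N * (2 * q - r) - 2 * p * q * (1 - 2 * r)\<^sup>2) *
      (3/2 * r + r\<^sup>2 + 21 * p + 10 * p * r - 8 * p * r\<^sup>2 - 8 * p\<^sup>2 - 88 * p\<^sup>2 * r + 16 * p\<^sup>2 * r\<^sup>2
        - 48 * p^3 + 96 * p^3 * r)"
    unfolding \<alpha>_def \<beta>_def \<gamma>_def M_def N h g q
    by (simp add: field_simps power2_eq_square power3_eq_cube)
  also have "\<dots> = 0" using cubic by simp
  finally have "?E = 0" using \<open>p \<noteq> q\<close> unfolding E by simp
  then show ?thesis by simp
qed

text \<open>In \<open>r = x + y\<close>, twice the variable of the cubic, its vanishing is the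
  elimination of \<open>B\<close> from \<open>(1 - 2 * r) * B = N\<close> and
  \<open>(2 * q - r) * B = 2 * p * q * (1 - 2 * r)\<close>.\<close>

lemma poly_drift_poly:
  assumes "q = 1/2 - p"
  shows "2 * poly (drift_poly p) (r / 2) =
    ((q - p) * r\<^sup>2 + 2 * p * r - p) * (2 * q - r) - 2 * p * q * (1 - 2 * r)\<^sup>2"
  unfolding assms drift_poly_def by (simp add: field_simps power2_eq_square)

lemma traffic_of_root:
  assumes p: "0 < p" "p < 1/4" and u: "0 < u" "u < 1/4" "poly (drift_poly p) u = 0"
  shows "\<exists>x y x' y'. traffic p (1/2 - p) x y x' y' \<and> x + y = 2 * u"
proof -
  define q where "q = 1/2 - p"
  define r where "r = 2 * u"
  define N where "N = (q - p) * r\<^sup>2 + 2 * p * r - p"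
  \<comment> \<open>With this \<open>B\<close> the cubic turns into the equation for
    \<open>r\<close>; \<open>u < 1/4\<close> makes \<open>B\<close> nonnegative.\<close>
  define B where "B = 2 * p * q * (1 - 2 * r) / (2 * q - r)"
  define g where "g = p + (q - p) * r"
  define a where "a = 1/2 + g + B"
  define D where "D = (a + q) * (a + p) - B\<^sup>2"
  have r: "0 < r" "r < 1/2" using u by (auto simp: r_def)
  have q: "1/4 < q" "p < q" using p by (auto simp: q_def)
  have qr: "0 < 2 * q - r" using q r by simp
  have B: "0 \<le> B" "(2 * q - r) * B = 2 * p * q * (1 - 2 * r)"
    using qr p q r by (auto simp: B_def)
  have cubic: "N * (2 * q - r) = 2 * p * q * (1 - 2 * r)\<^sup>2"
    using poly_drift_poly[of q p r] u(3) by (simp add: q_def N_def r_def)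
  have "(2 * q - r) * ((1 - 2 * r) * B) = (2 * q - r) * N"
  proof -
    have "(2 * q - r) * ((1 - 2 * r) * B) = (1 - 2 * r) * ((2 * q - r) * B)" by simp
    also have "\<dots> = 2 * p * q * (1 - 2 * r)\<^sup>2" unfolding B(2) by (simp add: power2_eq_square)
    finally show ?thesis using cubic by (simp only: mult.commute[of N])
  qed
  then have N: "(1 - 2 * r) * B = N" using qr by simp
  have B2: "2 * (q - p) * B = 4 * p * q * (1 - 2 * r) - N"
    using B(2) unfolding N[symmetric] by (simp add: q_def algebra_simps)
  have g: "0 < g" using p q r by (auto simp: g_def intro!: add_pos_pos)
  have "B * B < (a + q) * (a + p)"
    using p q g B by (intro mult_strict_mono) (auto simp: a_def)
  then have D: "D > 0" by (simp add: D_def power2_eq_square)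
  \<comment> \<open>Cramer's rule for the system with determinant \<open>D\<close>.\<close>
  define d where "d = (p * (a + p) - q * B) / D"
  define d' where "d' = (q * (a + q) - p * B) / D"
  have d: "(a + q) * d + B * d' = p" "B * d + (a + p) * d' = q"
    using D by (simp_all add: d_def d'_def field_simps) (simp_all add: D_def power2_eq_square algebra_simps)
  have "(1/2 - g - 2 * B) * D = p * (p * (a + p) - q * B) + q * (q * (a + q) - p * B)"
    unfolding D_def a_def
    by (rule consistency_of_cubic[OF q_def _ g_def HOL.refl N_def B2 cubic]) (use q in simp)
  moreover have "p * d + q * d' = (p * (p * (a + p) - q * B) + q * (q * (a + q) - p * B)) / D"
    by (simp add: d_def d'_def add_divide_distrib)
  ultimately have consistent: "p * d + q * d' = 1/2 - g - 2 * B"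
    using D by (simp add: nonzero_divide_eq_eq)
  have "traffic p q ((r + d) / 2) ((r - d) / 2) ((1 - r + d') / 2) ((1 - r - d') / 2)"
    by (rule traffic_of_linear_system[OF _ _ _ _ _ B(1) g_def N[unfolded N_def] d[unfolded a_def] consistent])
      (use p q r in \<open>auto simp: q_def\<close>)
  moreover have "(r + d) / 2 + (r - d) / 2 = 2 * u" by (simp add: r_def field_simps)
  ultimately show ?thesis unfolding q_def by blast
qed

text \<open>At \<open>p = q\<close> the value \<open>r = 1/2\<close> turns the equation relating
  \<open>r\<close> and \<open>B\<close> into \<open>0 = 0\<close>, so \<open>B\<close> is found from
  the consistency condition, here \<open>32 * B\<^sup>2 + 12 * B = 1\<close>, and
  \<open>d = d'\<close> by symmetry.\<close>

lemma traffic_quarter: "\<exists>x y x' y'. traffic (1/4) (1/4) x y x' y' \<and> x + y = 1/2"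
proof -
  define B :: real where "B = (sqrt 17 - 3) / 16"
  define d :: real where "d = 1 / (4 * (1 + 2 * B))"
  have "3 \<le> sqrt 17" by (rule real_le_rsqrt) simp
  then have B: "0 \<le> B" by (simp add: B_def)
  have "32 * B\<^sup>2 + 12 * B = 1"
    by (simp add: B_def power2_eq_square field_simps)
  then have cons: "1/4 * d + 1/4 * d = 1/2 - 1/4 - 2 * B"
    using B by (simp add: d_def field_simps power2_eq_square)
  have d: "(1 + 2 * B) * d = 1/4" using B by (simp add: d_def)
  have "traffic (1/4) (1/4) ((1/2 + d) / 2) ((1/2 - d) / 2) ((1 - 1/2 + d) / 2) ((1 - 1/2 - d) / 2)"
    by (rule traffic_of_linear_system[where B = B and g = "1/4"])
      (use B cons d in \<open>simp_all add: algebra_simps power2_eq_square\<close>)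
  moreover have "(1/2 + d) / 2 + (1/2 - d) / 2 = 1/2" by (simp add: field_simps)
  ultimately show ?thesis by blast
qed

text \<open>The polynomial changes sign between 0 and 1/4. Its zeros in this interval form a compact
  set, whose minimum lies below every zero beyond 1/4.\<close>

lemma smallest_root_exists:
  assumes "0 < p" "p < 1/4"
  obtains u where "is_smallest_root_01 (drift_poly p) u" "u < 1/4"
proof -
  let ?f = "poly (drift_poly p)"
  let ?Z = "{u \<in> {0..1/4}. ?f u = 0}"
  have f0: "?f 0 < 0" using assms by (simp add: drift_poly_def mult_pos_neg)
  have "2 * ?f (1/4) = (p - 1/4)\<^sup>2"
    by (simp add: drift_poly_def field_simps power2_eq_square)
  then have f1: "0 < ?f (1/4)" using assms by (smt (verit) zero_less_power2)
  obtain z where "0 < z" "z < 1/4" "?f z = 0"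
    using poly_IVT_pos[OF _ f0 f1] by auto
  then have "?Z \<noteq> {}" by force
  moreover have "compact ?Z"
  proof -
    have "closed (?f -` {0})" by (intro continuous_closed_vimage) auto
    then have "compact ({0..1/4} \<inter> ?f -` {0})" by (intro compact_Int_closed) auto
    moreover have "{0..1/4} \<inter> ?f -` {0} = ?Z" by auto
    ultimately show ?thesis by simp
  qed
  ultimately obtain u where u: "u \<in> ?Z" "\<And>v. v \<in> ?Z \<Longrightarrow> u \<le> v"
    using compact_attains_inf[of ?Z] by blast
  then have fu: "?f u = 0" "0 \<le> u" "u \<le> 1/4" by auto
  have "u \<noteq> 0" "u \<noteq> 1/4" using fu(1) f0 f1 by (metis less_irrefl)+
  with fu have bounds: "0 < u" "u < 1/4" by auto
  have "u \<le> v" if "0 < v" "?f v = 0" for v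
  proof (cases "v \<le> 1/4")
    case True
    with that show ?thesis by (intro u(2)) auto
  qed (use fu in linarith)
  then have "is_smallest_root_01 (drift_poly p) u"
    unfolding is_smallest_root_01_def using fu(1) bounds by auto
  then show ?thesis using bounds(2) by (rule that)
qed

lemma smallest_root_quarter: "is_smallest_root_01 (drift_poly (1/4)) (1/4)"
proof -
  have "poly (drift_poly (1/4)) v = - 2 * (v - 1/4)\<^sup>2" for v
    by (simp add: drift_poly_def field_simps power2_eq_square)
  then show ?thesis unfolding is_smallest_root_01_def by simp
qed

lemma traffic_of_smallest_root:
  assumes "0 < p" "p \<le> 1/4"
  obtains u x y x' y' where "is_smallest_root_01 (drift_poly p) u"
    "traffic p (1/2 - p) x y x' y'" "x + y = 2 * u"
proof (cases "p = 1/4")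
  case True
  obtain x y x' y' where xy: "traffic (1/4) (1/4) x y x' y'" "x + y = (1/2 :: real)"
    using traffic_quarter by blast
  show ?thesis
  proof (rule that)
    show "is_smallest_root_01 (drift_poly p) (1/4)"
      unfolding True by (rule smallest_root_quarter)
    show "traffic p (1/2 - p) x y x' y'"
      unfolding True using xy by simp
  qed (simp add: xy)
next
  case False
  with assms obtain u where u: "is_smallest_root_01 (drift_poly p) u" "u < 1/4"
    using smallest_root_exists[of p] by auto
  then have "0 < u" "poly (drift_poly p) u = 0" by (auto simp: is_smallest_root_01_def)
  then obtain x y x' y' where "traffic p (1/2 - p) x y x' y'" "x + y = 2 * u"
    using traffic_of_root[of p u] False assms u(2) by auto
  then show ?thesis using u(1) by (rule that[rotated])
qed

section \<open>Values of the four drifts\<close>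

lemma drifts_eq_speed:
  assumes "traffic p (1/2 - p) x y x' y'" and "v = traffic.speed p (1/2 - p) x y x' y'"
  shows "has_drift (step_law p) len_S (drift_S p)" "has_drift (step_law p) len_T (drift_T p)"
    "has_drift (step_law p) len_Splus (drift_Splus p)" "has_drift (step_law p) exp_Delta (drift_Delta p)"
    "drift_S p = v" "drift_T p = v" "drift_Splus p = 3/2 * v" "drift_Delta p = - v / 2"
proof -
  interpret traffic p "1/2 - p" x y x' y' by fact
  note drifts = has_drift_len_S has_drift_len_T has_drift_len_Splus has_drift_exp_Delta
  have eqs: "drift_S p = speed" "drift_T p = speed" "drift_Splus p = 3/2 * speed" "drift_Delta p = - speed / 2"
    unfolding drift_S_def drift_T_def drift_Splus_def drift_Delta_def by (rule drifts[THEN drift_eqI])+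
  show "has_drift (step_law p) len_S (drift_S p)" "has_drift (step_law p) len_T (drift_T p)"
    "has_drift (step_law p) len_Splus (drift_Splus p)" "has_drift (step_law p) exp_Delta (drift_Delta p)"
    unfolding eqs by (rule drifts)+
  show "drift_S p = v" "drift_T p = v" "drift_Splus p = 3/2 * v" "drift_Delta p = - v / 2"
    unfolding assms(2) by (rule eqs)+
qed

theorem proposition4p4:
  fixes p :: real
  assumes "0 < p" and "p < 1/2"
  shows
    "has_drift (step_law p) len_S (drift_S p) \<and>
     has_drift (step_law p) len_T (drift_T p) \<and>
     has_drift (step_law p) len_Splus (drift_Splus p) \<and>
     has_drift (step_law p) exp_Delta (drift_Delta p) \<and>
     (p \<le> 1/4 \<longrightarrow>
       (\<exists>u. is_smallest_root_01 (drift_poly p) u \<and>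
            drift_S p = p + (1 - 4 * p) * u \<and>
            drift_T p = p + (1 - 4 * p) * u \<and>
            - 2 * drift_Delta p = p + (1 - 4 * p) * u \<and>
            2 / 3 * drift_Splus p = p + (1 - 4 * p) * u)) \<and>
     (1/4 \<le> p \<longrightarrow>
       drift_S p = drift_S (1/2 - p) \<and>
       drift_T p = drift_T (1/2 - p) \<and>
       drift_Splus p = drift_Splus (1/2 - p) \<and>
       drift_Delta p = drift_Delta (1/2 - p))"
proof (cases "p \<le> 1/4")
  case True
  obtain u x y x' y' where u: "is_smallest_root_01 (drift_poly p) u"
    and traffic: "traffic p (1/2 - p) x y x' y'" and xy: "x + y = 2 * u"
    using traffic_of_smallest_root[OF assms(1) True] .
  have x'y': "x' + y' = 1 - 2 * u" using traffic.total[OF traffic] xy by simp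
  have "traffic.speed p (1/2 - p) x y x' y' = p + (1 - 4 * p) * u"
    unfolding traffic.speed_def[OF traffic] xy x'y' by (simp add: field_simps)
  note drifts = drifts_eq_speed[OF traffic this[symmetric]]
  \<comment> \<open>Both cases of the statement meet only at \<open>p = 1/4\<close>, where the
    symmetry is trivial.\<close>
  have half: "p = 1/2 - p" if "1/4 \<le> p" using True that by simp
  show ?thesis
    by (intro conjI impI exI[of _ u])
      (rule drifts(1-4) u | (rule arg_cong[OF half], assumption) | simp add: drifts(5-8))+
next
  case False
  then have p': "0 < 1/2 - p" "1/2 - p \<le> 1/4" using assms by auto
  obtain u x y x' y' where "is_smallest_root_01 (drift_poly (1/2 - p)) u"
    and traffic: "traffic (1/2 - p) (1/2 - (1/2 - p)) x y x' y'" and "x + y = 2 * u"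
    using traffic_of_smallest_root[OF p'] .
  \<comment> \<open>The solution for \<open>1/2 - p\<close> with its pairs exchanged solves the
    system for \<open>p\<close> and has the same speed.\<close>
  have traffic': "traffic p (1/2 - p) x' y' x y"
    using traffic_swap[OF traffic] by simp
  have "traffic.speed (1/2 - p) (1/2 - (1/2 - p)) x y x' y' = traffic.speed p (1/2 - p) x' y' x y"
    by (simp add: traffic.speed_def[OF traffic'] traffic.speed_def[OF traffic, simplified])
  note speed = this
  note drifts = drifts_eq_speed[OF traffic' HOL.refl] and drifts' = drifts_eq_speed(5-8)[OF traffic speed[symmetric]]
  show ?thesis using False
    by (intro conjI impI) (rule drifts(1-4) | simp add: drifts(5-8) drifts')+
qed

end
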